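(* Let $K$ be an arbitrary ring, $u_1,\dots,u_n\in\Lambda_n(K)$, and let $a\in\Lambda_n(K)$ be an unknown. Then the system of equations $$\partial_1(a)=u_1,\quad\partial_2(a)=u_2,\quad\dots,\quad\partial_n(a)=u_n$$ has a solution in $\Lambda_n$ if and only if the following two conditions hold: 1. for each $i=1,\dots,n$, $u_i\in K\lfloor x_1,\dots,\widehat{x_i},\dots,x_n\rfloor$, and 2. $\partial_i(u_j)=-\partial_j(u_i)$ for all $i\ne j$. In this case, $$a=\lambda+\sum_{\emptyset\ne\alpha\subseteq\{1,\dots,n\}}\phi(u_\alpha)x^\alpha,\qquad\lambda\in K,$$ are all the solutions, where $\phi=(1-x_n\partial_n)(1-x_{n-1}\partial_{n-1})\cdots(1-x_1\partial_1)$ and, for $\alpha=\{i_1<\cdots<i_k\}$, $u_\alpha:=\partial_{i_k}\partial_{i_{k-1}}\cdots\partial_{i_2}(u_{i_1})$.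
   Context: $K$ is an associative ring with $1$, not necessarily commutative. $\Lambda_n=\Lambda_n(K)$ is the Grassmann ring generated freely over $K$ by $x_1,\dots,x_n$ (commuting with the elements of $K$) subject to $x_i^2=0$, $x_ix_j=-x_jx_i$ ($i\ne j$); $\Lambda_n=\bigoplus_\alpha Kx^\alpha=\bigoplus_\alpha x^\alpha K$ with $x^\alpha=x_{i_1}\cdots x_{i_k}$, $\alpha=\{i_1<\dots<i_k\}\subseteq\{1,\dots,n\}$, graded by $|\alpha|$ with components $\Lambda_{n,d}$. $K\lfloor x_1,\dots,\widehat{x_i},\dots,x_n\rfloor$ is the subring generated over $K$ by the $x_j$, $j\ne i$. $\partial_i=\partial/\partial x_i$ is the left skew $K$-derivation of $\Lambda_n$: the additive map vanishing on $K$ with $\partial_i(x_j)=\delta_{ij}$ and $\partial_i(bc)=\partial_i(b)c+(-1)^db\,\partial_i(c)$ for $b\in\Lambda_{n,d}$, $c\in\Lambda_n$. In $\phi:\Lambda_n\to\Lambda_n$, $x_i$ acts by left multiplication; $\phi$ is the projection onto $K$ in $\Lambda_n=K\oplus\bigoplus_{d\ge1}\Lambda_{n,d}$. *)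

theory Defs
  imports "HOL-Algebra.Generated_Rings"
begin

text \<open>An element of the Grassmann ring over \<open>K\<close> is its family of coefficients: \<open>f\<close> stands for
  \<open>\<Sum>\<^sub>\<alpha> f(\<alpha>) x\<^sup>\<alpha>\<close>, with \<open>\<alpha>\<close> ranging over the subsets of \<open>{1..n}\<close>. In
  \<open>x\<^sup>\<alpha> x\<^sup>\<beta>\<close>, for disjoint \<open>\<alpha>\<close> and \<open>\<beta>\<close>, sorting the factors takes one transposition for
  each pair counted by \<open>inversions \<alpha> \<beta>\<close>.\<close>

definition inversions :: "nat set \<Rightarrow> nat set \<Rightarrow> nat" where
  "inversions A B = card {(a, b) \<in> A \<times> B. b < a}"

definition grassmann :: "('a, 'm) ring_scheme \<Rightarrow> nat \<Rightarrow> (nat set \<Rightarrow> 'a) ring" where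
  "grassmann K n = \<lparr>
     carrier = Pow {1..n} \<rightarrow>\<^sub>E carrier K,
     mult = (\<lambda>f g. \<lambda>\<gamma>\<in>Pow {1..n}. \<Oplus>\<^bsub>K\<^esub>\<alpha>\<in>Pow \<gamma>.
       (\<ominus>\<^bsub>K\<^esub> \<one>\<^bsub>K\<^esub>) [^]\<^bsub>K\<^esub> inversions \<alpha> (\<gamma> - \<alpha>) \<otimes>\<^bsub>K\<^esub> (f \<alpha> \<otimes>\<^bsub>K\<^esub> g (\<gamma> - \<alpha>))),
     one = (\<lambda>\<gamma>\<in>Pow {1..n}. if \<gamma> = {} then \<one>\<^bsub>K\<^esub> else \<zero>\<^bsub>K\<^esub>),
     zero = (\<lambda>\<gamma>\<in>Pow {1..n}. \<zero>\<^bsub>K\<^esub>),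
     add = (\<lambda>f g. \<lambda>\<gamma>\<in>Pow {1..n}. f \<gamma> \<oplus>\<^bsub>K\<^esub> g \<gamma>)\<rparr>"

definition gconst :: "('a, 'm) ring_scheme \<Rightarrow> nat \<Rightarrow> 'a \<Rightarrow> nat set \<Rightarrow> 'a" where
  "gconst K n k = (\<lambda>\<gamma>\<in>Pow {1..n}. if \<gamma> = {} then k else \<zero>\<^bsub>K\<^esub>)"

definition gvar :: "('a, 'm) ring_scheme \<Rightarrow> nat \<Rightarrow> nat \<Rightarrow> nat set \<Rightarrow> 'a" where
  "gvar K n i = (\<lambda>\<gamma>\<in>Pow {1..n}. if \<gamma> = {i} then \<one>\<^bsub>K\<^esub> else \<zero>\<^bsub>K\<^esub>)"

definition gmonom :: "('a, 'm) ring_scheme \<Rightarrow> nat \<Rightarrow> nat set \<Rightarrow> nat set \<Rightarrow> 'a" where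
  "gmonom K n \<alpha> = foldr (\<lambda>i m. gvar K n i \<otimes>\<^bsub>grassmann K n\<^esub> m)
     (sorted_list_of_set \<alpha>) \<one>\<^bsub>grassmann K n\<^esub>"

definition gcomponent :: "('a, 'm) ring_scheme \<Rightarrow> nat \<Rightarrow> nat \<Rightarrow> (nat set \<Rightarrow> 'a) set" where
  "gcomponent K n d = {f \<in> carrier (grassmann K n).
     \<forall>\<alpha>\<in>Pow {1..n}. card \<alpha> \<noteq> d \<longrightarrow> f \<alpha> = \<zero>\<^bsub>K\<^esub>}"

definition grassmann_omit :: "('a, 'm) ring_scheme \<Rightarrow> nat \<Rightarrow> nat \<Rightarrow> (nat set \<Rightarrow> 'a) set" where
  "grassmann_omit K n i = generate_ring (grassmann K n)
     (gconst K n ` carrier K \<union> gvar K n ` ({1..n} - {i}))"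

definition is_left_skew_partial ::
    "('a, 'm) ring_scheme \<Rightarrow> nat \<Rightarrow> nat \<Rightarrow> ((nat set \<Rightarrow> 'a) \<Rightarrow> (nat set \<Rightarrow> 'a)) \<Rightarrow> bool" where
  "is_left_skew_partial K n i D \<longleftrightarrow>
     D \<in> carrier (grassmann K n) \<rightarrow> carrier (grassmann K n) \<and>
     (\<forall>b\<in>carrier (grassmann K n). \<forall>c\<in>carrier (grassmann K n).
        D (b \<oplus>\<^bsub>grassmann K n\<^esub> c) = D b \<oplus>\<^bsub>grassmann K n\<^esub> D c) \<and>
     (\<forall>k\<in>carrier K. D (gconst K n k) = \<zero>\<^bsub>grassmann K n\<^esub>) \<and>
     (\<forall>j\<in>{1..n}. D (gvar K n j) =
        (if j = i then \<one>\<^bsub>grassmann K n\<^esub> else \<zero>\<^bsub>grassmann K n\<^esub>)) \<and>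
     (\<forall>d. \<forall>b\<in>gcomponent K n d. \<forall>c\<in>carrier (grassmann K n).
        D (b \<otimes>\<^bsub>grassmann K n\<^esub> c) =
          (D b \<otimes>\<^bsub>grassmann K n\<^esub> c) \<oplus>\<^bsub>grassmann K n\<^esub>
          ((\<ominus>\<^bsub>grassmann K n\<^esub> \<one>\<^bsub>grassmann K n\<^esub>) [^]\<^bsub>grassmann K n\<^esub> d
             \<otimes>\<^bsub>grassmann K n\<^esub> b \<otimes>\<^bsub>grassmann K n\<^esub> D c))"

text \<open>Such a map is determined on the carrier only, hence the restriction to extensional maps;
  existence and uniqueness are shown in \<open>ex1_left_skew_partial\<close> below.\<close>

definition gpartial :: "('a, 'm) ring_scheme \<Rightarrow> nat \<Rightarrow> nat \<Rightarrow> (nat set \<Rightarrow> 'a) \<Rightarrow> (nat set \<Rightarrow> 'a)" where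
  "gpartial K n i = (THE D. D \<in> extensional (carrier (grassmann K n)) \<and> is_left_skew_partial K n i D)"

text \<open>\<open>fold\<close> applies the operators for the earlier list entries first, so they are the rightmost
  factors of the composition: here \<open>1 - x\<^sub>1 \<partial>\<^sub>1\<close>, and in \<open>iterated_partial\<close> below the
  derivative with respect to the second smallest index.\<close>

definition gphi :: "('a, 'm) ring_scheme \<Rightarrow> nat \<Rightarrow> (nat set \<Rightarrow> 'a) \<Rightarrow> (nat set \<Rightarrow> 'a)" where
  "gphi K n = fold (\<lambda>i b. b \<ominus>\<^bsub>grassmann K n\<^esub> (gvar K n i \<otimes>\<^bsub>grassmann K n\<^esub> gpartial K n i b))
     [1..<Suc n]"

definition iterated_partial ::
    "('a, 'm) ring_scheme \<Rightarrow> nat \<Rightarrow> (nat \<Rightarrow> nat set \<Rightarrow> 'a) \<Rightarrow> nat set \<Rightarrow> (nat set \<Rightarrow> 'a)" where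
  "iterated_partial K n u \<alpha> =
     fold (gpartial K n) (tl (sorted_list_of_set \<alpha>)) (u (hd (sorted_list_of_set \<alpha>)))"


lemma inversions_empty [simp]: "inversions {} B = 0" "inversions A {} = 0"
  by (simp_all add: inversions_def)

lemma inversions_Un_left:
  assumes "finite A" "finite B" "finite C" "A \<inter> B = {}"
  shows "inversions (A \<union> B) C = inversions A C + inversions B C"
proof -
  have "{(a, b) \<in> (A \<union> B) \<times> C. b < a} = {(a, b) \<in> A \<times> C. b < a} \<union> {(a, b) \<in> B \<times> C. b < a}"
    by auto
  moreover have "finite {(a, b) \<in> A \<times> C. b < a}" "finite {(a, b) \<in> B \<times> C. b < a}"
    using assms by (auto intro: finite_subset[of _ "A \<times> C"] finite_subset[of _ "B \<times> C"])
  ultimately show ?thesis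
    using assms by (auto simp: inversions_def intro!: card_Un_disjoint)
qed

lemma inversions_Un_right:
  assumes "finite A" "finite B" "finite C" "B \<inter> C = {}"
  shows "inversions A (B \<union> C) = inversions A B + inversions A C"
proof -
  have "{(a, b) \<in> A \<times> (B \<union> C). b < a} = {(a, b) \<in> A \<times> B. b < a} \<union> {(a, b) \<in> A \<times> C. b < a}"
    by auto
  moreover have "finite {(a, b) \<in> A \<times> B. b < a}" "finite {(a, b) \<in> A \<times> C. b < a}"
    using assms by (auto intro: finite_subset[of _ "A \<times> B"] finite_subset[of _ "A \<times> C"])
  ultimately show ?thesis
    using assms by (auto simp: inversions_def intro!: card_Un_disjoint)
qed

lemma inversions_single:
  assumes "finite A" "i \<notin> A"
  shows "inversions {i} A + inversions A {i} = card A"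
proof -
  have 1: "{(a, b) \<in> {i} \<times> A. b < a} = Pair i ` {b \<in> A. b < i}"
    and 2: "{(a, b) \<in> A \<times> {i}. b < a} = (\<lambda>a. (a, i)) ` {a \<in> A. i < a}"
    by auto
  have "card A = card ({b \<in> A. b < i} \<union> {a \<in> A. i < a})"
    by (rule arg_cong[where f = card]) (use assms(2) in \<open>auto, metis nat_neq_iff\<close>)
  also have "\<dots> = card {b \<in> A. b < i} + card {a \<in> A. i < a}"
    using assms by (intro card_Un_disjoint) auto
  finally show ?thesis
    unfolding inversions_def 1 2 by (simp add: card_image inj_on_def)
qed

lemma inversions_le:
  assumes "\<And>a b. a \<in> A \<Longrightarrow> b \<in> B \<Longrightarrow> a \<le> b"
  shows "inversions A B = 0"
proof -
  have "{(a, b) \<in> A \<times> B. b < a} = {}"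
    using assms by fastforce
  then show ?thesis
    unfolding inversions_def by (metis card.empty)
qed

lemma (in abelian_monoid) finsum_Sigma_nested:
  assumes "finite A" "\<And>a. a \<in> A \<Longrightarrow> finite (B a)"
    and "\<And>a b. a \<in> A \<Longrightarrow> b \<in> B a \<Longrightarrow> f a b \<in> carrier G"
  shows "(\<Oplus>a\<in>A. \<Oplus>b\<in>B a. f a b) = (\<Oplus>p\<in>Sigma A B. f (fst p) (snd p))"
  using assms
proof (induction A rule: finite_induct)
  case empty
  then show ?case by simp
next
  case (insert x A)
  have S: "Sigma (insert x A) B = Pair x ` B x \<union> Sigma A B" by auto
  have "(\<Oplus>p\<in>Sigma (insert x A) B. f (fst p) (snd p)) =
      (\<Oplus>p\<in>Pair x ` B x. f (fst p) (snd p)) \<oplus> (\<Oplus>p\<in>Sigma A B. f (fst p) (snd p))"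
    unfolding S using insert by (intro finsum_Un_disjoint) auto
  also have "(\<Oplus>p\<in>Pair x ` B x. f (fst p) (snd p)) = (\<Oplus>b\<in>B x. f x b)"
    using insert by (subst finsum_reindex) (auto simp: inj_on_def)
  also have "(\<Oplus>p\<in>Sigma A B. f (fst p) (snd p)) = (\<Oplus>a\<in>A. \<Oplus>b\<in>B a. f a b)"
    using insert by simp
  also have "(\<Oplus>b\<in>B x. f x b) \<oplus> (\<Oplus>a\<in>A. \<Oplus>b\<in>B a. f a b) = (\<Oplus>a\<in>insert x A. \<Oplus>b\<in>B a. f a b)"
    using insert by (subst finsum_insert) (auto intro!: finsum_closed)
  finally show ?case by simp
qed

context ring
begin

definition gsign :: "nat \<Rightarrow> 'a \<Rightarrow> 'a" where
  "gsign m z = (\<ominus> \<one>) [^] m \<otimes> z"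

lemma gsign_closed [simp]: "z \<in> carrier R \<Longrightarrow> gsign m z \<in> carrier R"
  by (simp add: gsign_def)

lemma gsign_eq: "z \<in> carrier R \<Longrightarrow> gsign m z = (if even m then z else \<ominus> z)"
proof -
  have "(\<ominus> \<one>) [^] m = (if even m then \<one> else \<ominus> \<one>)"
    by (induction m) (auto simp: l_minus r_minus minus_minus)
  then show "z \<in> carrier R \<Longrightarrow> ?thesis" by (simp add: gsign_def l_minus)
qed

lemma gsign_0 [simp]: "z \<in> carrier R \<Longrightarrow> gsign 0 z = z"
  by (simp add: gsign_eq)

lemma gsign_zero [simp]: "gsign m \<zero> = \<zero>"
  by (simp add: gsign_eq)

lemma gsign_gsign: "z \<in> carrier R \<Longrightarrow> gsign m (gsign k z) = gsign (m + k) z"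
  by (simp add: gsign_eq minus_minus)

lemma gsign_mult_left: "y \<in> carrier R \<Longrightarrow> z \<in> carrier R \<Longrightarrow> gsign m y \<otimes> z = gsign m (y \<otimes> z)"
  by (simp add: gsign_eq l_minus)

lemma gsign_mult_right: "y \<in> carrier R \<Longrightarrow> z \<in> carrier R \<Longrightarrow> y \<otimes> gsign m z = gsign m (y \<otimes> z)"
  by (simp add: gsign_eq r_minus)

lemma gsign_add: "y \<in> carrier R \<Longrightarrow> z \<in> carrier R \<Longrightarrow> gsign m (y \<oplus> z) = gsign m y \<oplus> gsign m z"
  by (simp add: gsign_def r_distr)

lemma gsign_finsum:
  "finite A \<Longrightarrow> f \<in> A \<rightarrow> carrier R \<Longrightarrow> gsign m (finsum R f A) = (\<Oplus>a\<in>A. gsign m (f a))"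
  unfolding gsign_def by (rule finsum_rdistr) auto

lemma gsign_cong: "z \<in> carrier R \<Longrightarrow> even m = even k \<Longrightarrow> gsign m z = gsign k z"
  by (simp add: gsign_eq)

lemma gcarrier: "carrier (grassmann R n) = Pow {1..n} \<rightarrow>\<^sub>E carrier R"
  by (simp add: grassmann_def)

lemma gcoeff_closed [simp]:
  "f \<in> carrier (grassmann R n) \<Longrightarrow> \<gamma> \<subseteq> {1..n} \<Longrightarrow> f \<gamma> \<in> carrier R"
  by (auto simp: gcarrier)

lemma gcoeff_closed_Suc [simp]:
  "f \<in> carrier (grassmann R n) \<Longrightarrow> \<gamma> \<subseteq> {Suc 0..n} \<Longrightarrow> f \<gamma> \<in> carrier R"
  using gcoeff_closed[of f n \<gamma>] by simp

lemma gcoeff_eqI: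
  assumes "f \<in> carrier (grassmann R n)" "g \<in> carrier (grassmann R n)"
    and "\<And>\<gamma>. \<gamma> \<subseteq> {1..n} \<Longrightarrow> f \<gamma> = g \<gamma>"
  shows "f = g"
  by (rule PiE_ext) (use assms in \<open>auto simp: gcarrier\<close>)

lemma gcoeff_add [simp]: "\<gamma> \<subseteq> {1..n} \<Longrightarrow> (f \<oplus>\<^bsub>grassmann R n\<^esub> g) \<gamma> = f \<gamma> \<oplus> g \<gamma>"
  by (simp add: grassmann_def)

lemma gcoeff_zero [simp]: "\<gamma> \<subseteq> {1..n} \<Longrightarrow> \<zero>\<^bsub>grassmann R n\<^esub> \<gamma> = \<zero>"
  by (simp add: grassmann_def)

lemma gcoeff_one [simp]: "\<gamma> \<subseteq> {1..n} \<Longrightarrow> \<one>\<^bsub>grassmann R n\<^esub> \<gamma> = (if \<gamma> = {} then \<one> else \<zero>)"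
  by (simp add: grassmann_def)

lemma gcoeff_mult: "\<gamma> \<subseteq> {1..n} \<Longrightarrow> (f \<otimes>\<^bsub>grassmann R n\<^esub> g) \<gamma> =
    (\<Oplus>\<alpha>\<in>Pow \<gamma>. gsign (inversions \<alpha> (\<gamma> - \<alpha>)) (f \<alpha> \<otimes> g (\<gamma> - \<alpha>)))"
  by (simp add: grassmann_def gsign_def)

lemma gone_closed: "\<one>\<^bsub>grassmann R n\<^esub> \<in> carrier (grassmann R n)"
  and gzero_closed: "\<zero>\<^bsub>grassmann R n\<^esub> \<in> carrier (grassmann R n)"
  and gconst_closed: "k \<in> carrier R \<Longrightarrow> gconst R n k \<in> carrier (grassmann R n)"
  and gvar_closed: "gvar R n i \<in> carrier (grassmann R n)"
  by (auto simp: grassmann_def gconst_def gvar_def)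

lemma gadd_closed:
  "f \<in> carrier (grassmann R n) \<Longrightarrow> g \<in> carrier (grassmann R n) \<Longrightarrow>
    f \<oplus>\<^bsub>grassmann R n\<^esub> g \<in> carrier (grassmann R n)"
  by (auto simp: grassmann_def intro!: a_closed)

lemma gterm_closed:
  "f \<in> carrier (grassmann R n) \<Longrightarrow> g \<in> carrier (grassmann R n) \<Longrightarrow> \<gamma> \<subseteq> {1..n} \<Longrightarrow> \<alpha> \<subseteq> \<gamma> \<Longrightarrow>
    f \<alpha> \<otimes> g (\<gamma> - \<alpha>) \<in> carrier R"
  by (intro m_closed gcoeff_closed[of _ n]) auto

lemma gmult_closed:
  assumes "f \<in> carrier (grassmann R n)" "g \<in> carrier (grassmann R n)"
  shows "f \<otimes>\<^bsub>grassmann R n\<^esub> g \<in> carrier (grassmann R n)"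
proof -
  have "(f \<otimes>\<^bsub>grassmann R n\<^esub> g) \<gamma> \<in> carrier R" if "\<gamma> \<subseteq> {1..n}" for \<gamma>
    unfolding gcoeff_mult[OF that] using assms that
    by (intro finsum_closed) (auto intro!: gsign_closed gterm_closed)
  moreover have "f \<otimes>\<^bsub>grassmann R n\<^esub> g \<in> extensional (Pow {1..n})"
    by (simp add: grassmann_def)
  ultimately show ?thesis unfolding gcarrier PiE_iff by blast
qed

lemma gmult_assoc:
  assumes f: "f \<in> carrier (grassmann R n)" and g: "g \<in> carrier (grassmann R n)"
    and h: "h \<in> carrier (grassmann R n)"
  shows "f \<otimes>\<^bsub>grassmann R n\<^esub> g \<otimes>\<^bsub>grassmann R n\<^esub> h = f \<otimes>\<^bsub>grassmann R n\<^esub> (g \<otimes>\<^bsub>grassmann R n\<^esub> h)"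
proof (rule gcoeff_eqI[of _ n])
  fix \<gamma> :: "nat set" assume \<gamma>: "\<gamma> \<subseteq> {1..n}"
  have fin: "finite \<gamma>" using \<gamma> finite_subset by blast
  have fs: "finite A" if "A \<subseteq> \<gamma>" for A using that fin finite_subset by blast
  have cf: "F A \<in> carrier R" if "F \<in> carrier (grassmann R n)" "A \<subseteq> \<gamma>" for F A
    using that \<gamma> by (intro gcoeff_closed[of _ n]) auto
  define P where "P A B = gsign (inversions A B + inversions A (\<gamma> - A - B) + inversions B (\<gamma> - A - B))
      (f A \<otimes> g B \<otimes> h (\<gamma> - A - B))" for A B
  have Pc: "P A B \<in> carrier R" if "A \<subseteq> \<gamma>" "B \<subseteq> \<gamma>" for A B
    unfolding P_def by (intro gsign_closed m_closed cf f g h) (use that in auto)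
  let ?X = "Sigma (Pow \<gamma>) (\<lambda>A. Pow (\<gamma> - A))"
  let ?Y = "Sigma (Pow \<gamma>) Pow"
  have "(f \<otimes>\<^bsub>grassmann R n\<^esub> g \<otimes>\<^bsub>grassmann R n\<^esub> h) \<gamma> = (\<Oplus>T\<in>Pow \<gamma>. \<Oplus>A\<in>Pow T. P A (T - A))"
    unfolding gcoeff_mult[OF \<gamma>]
  proof (intro finsum_cong' refl)
    show "(\<lambda>T. \<Oplus>A\<in>Pow T. P A (T - A)) \<in> Pow \<gamma> \<rightarrow> carrier R"
      by (auto intro!: finsum_closed Pc)
    fix T assume "T \<in> Pow \<gamma>"
    then have T: "T \<subseteq> \<gamma>" "T \<subseteq> {1..n}" using \<gamma> by auto
    have "gsign (inversions T (\<gamma> - T)) ((f \<otimes>\<^bsub>grassmann R n\<^esub> g) T \<otimes> h (\<gamma> - T)) =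
        gsign (inversions T (\<gamma> - T)) (\<Oplus>A\<in>Pow T. gsign (inversions A (T - A)) (f A \<otimes> g (T - A)) \<otimes> h (\<gamma> - T))"
      unfolding gcoeff_mult[OF T(2)] using T fs
      by (subst finsum_ldistr) (auto intro!: cf f g h gsign_closed m_closed)
    also have "\<dots> = (\<Oplus>A\<in>Pow T. gsign (inversions T (\<gamma> - T)) (gsign (inversions A (T - A)) (f A \<otimes> g (T - A)) \<otimes> h (\<gamma> - T)))"
      using T fs by (subst gsign_finsum) (auto intro!: cf f g h gsign_closed m_closed)
    also have "\<dots> = (\<Oplus>A\<in>Pow T. P A (T - A))"
    proof (intro finsum_cong' refl)
      show "(\<lambda>A. P A (T - A)) \<in> Pow T \<rightarrow> carrier R"
        using T by (auto intro!: Pc)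
      fix A assume "A \<in> Pow T"
      then have A: "A \<subseteq> T" by simp
      then have TA: "T = A \<union> (T - A)" by auto
      have c: "f A \<in> carrier R" "g (T - A) \<in> carrier R" "h (\<gamma> - T) \<in> carrier R"
        by (rule cf; use A T f g h in auto)+
      have D: "\<gamma> - A - (T - A) = \<gamma> - T" using A T by auto
      have I: "inversions T (\<gamma> - T) = inversions A (\<gamma> - T) + inversions (T - A) (\<gamma> - T)"
        by (subst TA, rule inversions_Un_left) (use A T fs in auto)
      show "gsign (inversions T (\<gamma> - T)) (gsign (inversions A (T - A)) (f A \<otimes> g (T - A)) \<otimes> h (\<gamma> - T)) = P A (T - A)"
        using c by (simp add: P_def D I gsign_mult_left gsign_gsign add.commute add.left_commute)
    qed
    finally show "gsign (inversions T (\<gamma> - T)) ((f \<otimes>\<^bsub>grassmann R n\<^esub> g) T \<otimes> h (\<gamma> - T)) =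
      (\<Oplus>A\<in>Pow T. P A (T - A))" .
  qed
  also have "\<dots> = (\<Oplus>p\<in>?Y. P (snd p) (fst p - snd p))"
    using fin fs by (subst finsum_Sigma_nested) (auto intro!: Pc)
  also have Y: "?Y = (\<lambda>(A, B). (A \<union> B, A)) ` ?X"
  proof (intro subset_antisym subsetI)
    fix p assume "p \<in> ?Y"
    then obtain T A where p: "p = (T, A)" and "T \<subseteq> \<gamma>" "A \<subseteq> T" by auto
    then have "(A, T - A) \<in> ?X" "p = (\<lambda>(A, B). (A \<union> B, A)) (A, T - A)" by auto
    then show "p \<in> (\<lambda>(A, B). (A \<union> B, A)) ` ?X" by (rule rev_image_eqI)
  qed auto
  also have "(\<Oplus>p\<in>(\<lambda>(A, B). (A \<union> B, A)) ` ?X. P (snd p) (fst p - snd p)) =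
      (\<Oplus>p\<in>?X. P (fst p) (snd p))"
  proof (subst finsum_reindex)
    show "inj_on (\<lambda>(A, B). (A \<union> B, A)) ?X" by (auto simp: inj_on_def)
    show "(\<lambda>p. P (snd p) (fst p - snd p)) \<in> (\<lambda>(A, B). (A \<union> B, A)) ` ?X \<rightarrow> carrier R"
      by (auto intro!: Pc)
    show "(\<Oplus>x\<in>?X. P (snd ((\<lambda>(A, B). (A \<union> B, A)) x)) (fst ((\<lambda>(A, B). (A \<union> B, A)) x) - snd ((\<lambda>(A, B). (A \<union> B, A)) x)))
        = (\<Oplus>p\<in>?X. P (fst p) (snd p))"
    proof (intro finsum_cong' refl)
      show "(\<lambda>p. P (fst p) (snd p)) \<in> ?X \<rightarrow> carrier R" by (auto intro!: Pc)
      fix x assume "x \<in> ?X"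
      then obtain A B where x: "x = (A, B)" and "B \<subseteq> \<gamma> - A" by auto
      then have "A \<union> B - A = B" by auto
      then show "P (snd ((\<lambda>(A, B). (A \<union> B, A)) x)) (fst ((\<lambda>(A, B). (A \<union> B, A)) x) - snd ((\<lambda>(A, B). (A \<union> B, A)) x)) = P (fst x) (snd x)"
        by (simp add: x)
    qed
  qed
  also have "\<dots> = (\<Oplus>A\<in>Pow \<gamma>. \<Oplus>B\<in>Pow (\<gamma> - A). P A B)"
    using fin fs by (subst finsum_Sigma_nested) (auto intro!: Pc)
  also have "\<dots> = (f \<otimes>\<^bsub>grassmann R n\<^esub> (g \<otimes>\<^bsub>grassmann R n\<^esub> h)) \<gamma>"
    unfolding gcoeff_mult[OF \<gamma>]
  proof (intro finsum_cong' refl)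
    fix A assume "A \<in> Pow \<gamma>"
    then have A: "A \<subseteq> \<gamma>" "\<gamma> - A \<subseteq> {1..n}" using \<gamma> by auto
    have "gsign (inversions A (\<gamma> - A)) (f A \<otimes> (g \<otimes>\<^bsub>grassmann R n\<^esub> h) (\<gamma> - A)) =
        gsign (inversions A (\<gamma> - A)) (\<Oplus>B\<in>Pow (\<gamma> - A). f A \<otimes> gsign (inversions B (\<gamma> - A - B)) (g B \<otimes> h (\<gamma> - A - B)))"
      unfolding gcoeff_mult[OF A(2)] using A fs
      by (subst finsum_rdistr) (auto intro!: cf f g h gsign_closed m_closed)
    also have "\<dots> = (\<Oplus>B\<in>Pow (\<gamma> - A). gsign (inversions A (\<gamma> - A)) (f A \<otimes> gsign (inversions B (\<gamma> - A - B)) (g B \<otimes> h (\<gamma> - A - B))))"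
      using A fs by (subst gsign_finsum) (auto intro!: cf f g h gsign_closed m_closed)
    also have "\<dots> = (\<Oplus>B\<in>Pow (\<gamma> - A). P A B)"
    proof (intro finsum_cong' refl)
      show "(\<lambda>B. P A B) \<in> Pow (\<gamma> - A) \<rightarrow> carrier R"
        using A by (auto intro!: Pc)
      fix B assume "B \<in> Pow (\<gamma> - A)"
      then have B: "B \<subseteq> \<gamma> - A" by simp
      then have AB: "\<gamma> - A = B \<union> (\<gamma> - A - B)" by auto
      have c: "f A \<in> carrier R" "g B \<in> carrier R" "h (\<gamma> - A - B) \<in> carrier R"
        by (rule cf; use A B f g h in auto)+
      have "inversions A (B \<union> (\<gamma> - A - B)) = inversions A B + inversions A (\<gamma> - A - B)"
        by (rule inversions_Un_right) (use A B fs[OF A(1)] fs[of B] fs[of "\<gamma> - A - B"] in blast)+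
      then have I: "inversions A (\<gamma> - A) = inversions A B + inversions A (\<gamma> - A - B)"
        using AB by simp
      show "gsign (inversions A (\<gamma> - A)) (f A \<otimes> gsign (inversions B (\<gamma> - A - B)) (g B \<otimes> h (\<gamma> - A - B))) = P A B"
        using c by (simp add: P_def I gsign_mult_right gsign_gsign m_assoc add.commute add.left_commute)
    qed
    finally show "(\<Oplus>B\<in>Pow (\<gamma> - A). P A B) =
      gsign (inversions A (\<gamma> - A)) (f A \<otimes> (g \<otimes>\<^bsub>grassmann R n\<^esub> h) (\<gamma> - A))" by simp
  next
    show "(\<lambda>\<alpha>. gsign (inversions \<alpha> (\<gamma> - \<alpha>)) (f \<alpha> \<otimes> (g \<otimes>\<^bsub>grassmann R n\<^esub> h) (\<gamma> - \<alpha>))) \<in> Pow \<gamma> \<rightarrow> carrier R"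
      using cf[OF f] cf[OF gmult_closed[OF g h]] by (intro funcsetI gsign_closed m_closed) auto
  qed
  finally show "(f \<otimes>\<^bsub>grassmann R n\<^esub> g \<otimes>\<^bsub>grassmann R n\<^esub> h) \<gamma> = (f \<otimes>\<^bsub>grassmann R n\<^esub> (g \<otimes>\<^bsub>grassmann R n\<^esub> h)) \<gamma>" .
qed (use f g h gmult_closed in auto)

lemma gcoeff_const_mult:
  assumes "k \<in> carrier R" "f \<in> carrier (grassmann R n)" "\<gamma> \<subseteq> {1..n}"
  shows "(gconst R n k \<otimes>\<^bsub>grassmann R n\<^esub> f) \<gamma> = k \<otimes> f \<gamma>"
proof -
  have fin: "finite \<gamma>" using assms finite_subset by blast
  have "(gconst R n k \<otimes>\<^bsub>grassmann R n\<^esub> f) \<gamma> = (\<Oplus>\<alpha>\<in>Pow \<gamma>. if \<alpha> = {} then k \<otimes> f \<gamma> else \<zero>)"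
    unfolding gcoeff_mult[OF assms(3)]
  proof (intro finsum_cong' refl)
    fix A assume "A \<in> Pow \<gamma>"
    then have "A \<subseteq> {1..n}" "f (\<gamma> - A) \<in> carrier R" using assms by (auto intro: gcoeff_closed_Suc[of _ n])
    then show "gsign (inversions A (\<gamma> - A)) (gconst R n k A \<otimes> f (\<gamma> - A)) = (if A = {} then k \<otimes> f \<gamma> else \<zero>)"
      using assms by (auto simp: gconst_def)
  qed (use assms in auto)
  also have "\<dots> = k \<otimes> f \<gamma>"
    using assms fin by (intro add.finprod_singleton_swap[where f = "\<lambda>_. k \<otimes> f \<gamma>"]) auto
  finally show ?thesis .
qed

lemma gcoeff_mult_const:
  assumes "k \<in> carrier R" "f \<in> carrier (grassmann R n)" "\<gamma> \<subseteq> {1..n}"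
  shows "(f \<otimes>\<^bsub>grassmann R n\<^esub> gconst R n k) \<gamma> = f \<gamma> \<otimes> k"
proof -
  have fin: "finite \<gamma>" using assms finite_subset by blast
  have "(f \<otimes>\<^bsub>grassmann R n\<^esub> gconst R n k) \<gamma> = (\<Oplus>\<alpha>\<in>Pow \<gamma>. if \<alpha> = \<gamma> then f \<gamma> \<otimes> k else \<zero>)"
    unfolding gcoeff_mult[OF assms(3)]
  proof (intro finsum_cong' refl)
    fix A assume "A \<in> Pow \<gamma>"
    then have "\<gamma> - A \<subseteq> {1..n}" "f A \<in> carrier R" "\<gamma> - A = {} \<longleftrightarrow> A = \<gamma>"
      using assms by (auto intro: gcoeff_closed_Suc[of _ n])
    then show "gsign (inversions A (\<gamma> - A)) (f A \<otimes> gconst R n k (\<gamma> - A)) = (if A = \<gamma> then f \<gamma> \<otimes> k else \<zero>)"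
      using assms by (auto simp: gconst_def)
  qed (use assms in auto)
  also have "\<dots> = f \<gamma> \<otimes> k"
    using assms fin by (intro add.finprod_singleton_swap[where f = "\<lambda>_. f \<gamma> \<otimes> k"]) auto
  finally show ?thesis .
qed

lemma gcoeff_var_mult:
  assumes "i \<in> {1..n}" "f \<in> carrier (grassmann R n)" "\<gamma> \<subseteq> {1..n}"
  shows "(gvar R n i \<otimes>\<^bsub>grassmann R n\<^esub> f) \<gamma> =
    (if i \<in> \<gamma> then gsign (inversions {i} (\<gamma> - {i})) (f (\<gamma> - {i})) else \<zero>)"
proof -
  have fin: "finite \<gamma>" using assms finite_subset by blast
  let ?v = "gsign (inversions {i} (\<gamma> - {i})) (f (\<gamma> - {i}))"
  have v: "?v \<in> carrier R" using assms by (auto intro!: gsign_closed gcoeff_closed[of _ n])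
  have "(gvar R n i \<otimes>\<^bsub>grassmann R n\<^esub> f) \<gamma> = (\<Oplus>\<alpha>\<in>Pow \<gamma>. if \<alpha> = {i} then ?v else \<zero>)"
    unfolding gcoeff_mult[OF assms(3)]
  proof (intro finsum_cong' refl)
    fix A assume "A \<in> Pow \<gamma>"
    then have "A \<subseteq> {1..n}" "f (\<gamma> - A) \<in> carrier R"
      using assms by (auto intro: gcoeff_closed_Suc[of _ n])
    then show "gsign (inversions A (\<gamma> - A)) (gvar R n i A \<otimes> f (\<gamma> - A)) = (if A = {i} then ?v else \<zero>)"
      using assms by (auto simp: gvar_def)
  qed (use v in auto)
  also have "\<dots> = (if i \<in> \<gamma> then ?v else \<zero>)"
  proof (cases "i \<in> \<gamma>")
    case True
    then have "(\<Oplus>\<alpha>\<in>Pow \<gamma>. if \<alpha> = {i} then ?v else \<zero>) = ?v"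
      using fin v by (intro add.finprod_singleton_swap[where f = "\<lambda>_. ?v"]) auto
    with True show ?thesis by simp
  next
    case False
    then have "(\<Oplus>\<alpha>\<in>Pow \<gamma>. if \<alpha> = {i} then ?v else \<zero>) = \<zero>"
      by (intro add.finprod_one_eqI) auto
    with False show ?thesis by simp
  qed
  finally show ?thesis .
qed

lemma gone_eq: "\<one>\<^bsub>grassmann R n\<^esub> = gconst R n \<one>"
  by (simp add: grassmann_def gconst_def)

lemma gmult_distr:
  assumes f: "f \<in> carrier (grassmann R n)" and g: "g \<in> carrier (grassmann R n)"
    and h: "h \<in> carrier (grassmann R n)"
  shows "(f \<oplus>\<^bsub>grassmann R n\<^esub> g) \<otimes>\<^bsub>grassmann R n\<^esub> h =
      (f \<otimes>\<^bsub>grassmann R n\<^esub> h) \<oplus>\<^bsub>grassmann R n\<^esub> (g \<otimes>\<^bsub>grassmann R n\<^esub> h)" (is ?A)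
    and "h \<otimes>\<^bsub>grassmann R n\<^esub> (f \<oplus>\<^bsub>grassmann R n\<^esub> g) =
      (h \<otimes>\<^bsub>grassmann R n\<^esub> f) \<oplus>\<^bsub>grassmann R n\<^esub> (h \<otimes>\<^bsub>grassmann R n\<^esub> g)" (is ?B)
proof -
  have T: "gsign m (F A \<otimes> G (\<gamma> - A)) \<in> carrier R"
    if "F \<in> carrier (grassmann R n)" "G \<in> carrier (grassmann R n)" "\<gamma> \<subseteq> {1..n}" "A \<in> Pow \<gamma>" for F G m \<gamma> A
    using that by (auto intro!: gsign_closed gterm_closed)
  show ?A
  proof (rule gcoeff_eqI[of _ n])
    fix \<gamma> :: "nat set" assume \<gamma>: "\<gamma> \<subseteq> {1..n}"
    have "((f \<oplus>\<^bsub>grassmann R n\<^esub> g) \<otimes>\<^bsub>grassmann R n\<^esub> h) \<gamma> = (\<Oplus>A\<in>Pow \<gamma>.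
        gsign (inversions A (\<gamma> - A)) (f A \<otimes> h (\<gamma> - A)) \<oplus> gsign (inversions A (\<gamma> - A)) (g A \<otimes> h (\<gamma> - A)))"
      unfolding gcoeff_mult[OF \<gamma>]
    proof (intro finsum_cong' refl)
      fix A assume "A \<in> Pow \<gamma>"
      then have A: "A \<subseteq> {1..n}" "\<gamma> - A \<subseteq> {1..n}" using \<gamma> by auto
      then show "gsign (inversions A (\<gamma> - A)) ((f \<oplus>\<^bsub>grassmann R n\<^esub> g) A \<otimes> h (\<gamma> - A)) =
        gsign (inversions A (\<gamma> - A)) (f A \<otimes> h (\<gamma> - A)) \<oplus> gsign (inversions A (\<gamma> - A)) (g A \<otimes> h (\<gamma> - A))"
        using f g h by (simp add: l_distr gsign_add gcoeff_closed[of _ n])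
    qed (use f g h \<gamma> T in \<open>auto intro!: a_closed\<close>)
    also have "\<dots> = ((f \<otimes>\<^bsub>grassmann R n\<^esub> h) \<oplus>\<^bsub>grassmann R n\<^esub> (g \<otimes>\<^bsub>grassmann R n\<^esub> h)) \<gamma>"
      unfolding gcoeff_add[OF \<gamma>] gcoeff_mult[OF \<gamma>]
      by (rule finsum_addf) (use f g h \<gamma> T in auto)
    finally show "((f \<oplus>\<^bsub>grassmann R n\<^esub> g) \<otimes>\<^bsub>grassmann R n\<^esub> h) \<gamma> = \<dots>" .
  qed (use f g h gmult_closed gadd_closed in auto)
  show ?B
  proof (rule gcoeff_eqI[of _ n])
    fix \<gamma> :: "nat set" assume \<gamma>: "\<gamma> \<subseteq> {1..n}"
    have "(h \<otimes>\<^bsub>grassmann R n\<^esub> (f \<oplus>\<^bsub>grassmann R n\<^esub> g)) \<gamma> = (\<Oplus>A\<in>Pow \<gamma>.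
        gsign (inversions A (\<gamma> - A)) (h A \<otimes> f (\<gamma> - A)) \<oplus> gsign (inversions A (\<gamma> - A)) (h A \<otimes> g (\<gamma> - A)))"
      unfolding gcoeff_mult[OF \<gamma>]
    proof (intro finsum_cong' refl)
      fix A assume "A \<in> Pow \<gamma>"
      then have A: "A \<subseteq> {1..n}" "\<gamma> - A \<subseteq> {1..n}" using \<gamma> by auto
      then show "gsign (inversions A (\<gamma> - A)) (h A \<otimes> (f \<oplus>\<^bsub>grassmann R n\<^esub> g) (\<gamma> - A)) =
        gsign (inversions A (\<gamma> - A)) (h A \<otimes> f (\<gamma> - A)) \<oplus> gsign (inversions A (\<gamma> - A)) (h A \<otimes> g (\<gamma> - A))"
        using f g h by (simp add: r_distr gsign_add gcoeff_closed[of _ n])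
    qed (use f g h \<gamma> T in \<open>auto intro!: a_closed\<close>)
    also have "\<dots> = ((h \<otimes>\<^bsub>grassmann R n\<^esub> f) \<oplus>\<^bsub>grassmann R n\<^esub> (h \<otimes>\<^bsub>grassmann R n\<^esub> g)) \<gamma>"
      unfolding gcoeff_add[OF \<gamma>] gcoeff_mult[OF \<gamma>]
      by (rule finsum_addf) (use f g h \<gamma> T in auto)
    finally show "(h \<otimes>\<^bsub>grassmann R n\<^esub> (f \<oplus>\<^bsub>grassmann R n\<^esub> g)) \<gamma> = \<dots>" .
  qed (use f g h gmult_closed gadd_closed in auto)
qed

lemma ring_grassmann: "ring (grassmann R n)"
proof (rule ringI)
  show "abelian_group (grassmann R n)"
  proof (rule abelian_groupI)
    fix x assume x: "x \<in> carrier (grassmann R n)"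
    let ?y = "\<lambda>\<gamma>\<in>Pow {1..n}. \<ominus> x \<gamma>"
    have y: "?y \<in> carrier (grassmann R n)"
      using x by (auto simp: gcarrier)
    moreover have "?y \<oplus>\<^bsub>grassmann R n\<^esub> x = \<zero>\<^bsub>grassmann R n\<^esub>"
      by (rule gcoeff_eqI[of _ n]) (use x y gadd_closed gzero_closed in \<open>auto simp: l_neg\<close>)
    ultimately show "\<exists>y\<in>carrier (grassmann R n). y \<oplus>\<^bsub>grassmann R n\<^esub> x = \<zero>\<^bsub>grassmann R n\<^esub>" by blast
  qed (auto intro!: gcoeff_eqI[of _ n] gadd_closed gzero_closed simp: a_ac)
  show "monoid (grassmann R n)"
  proof (rule monoidI)
    fix x assume x: "x \<in> carrier (grassmann R n)"
    show "\<one>\<^bsub>grassmann R n\<^esub> \<otimes>\<^bsub>grassmann R n\<^esub> x = x" "x \<otimes>\<^bsub>grassmann R n\<^esub> \<one>\<^bsub>grassmann R n\<^esub> = x"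
      unfolding gone_eq
      by (rule gcoeff_eqI[of _ n];
          use x in \<open>auto intro!: gmult_closed gconst_closed simp: gcoeff_const_mult gcoeff_mult_const\<close>)+
  qed (auto intro: gmult_closed gone_closed gmult_assoc)
qed (auto intro: gmult_distr)

lemma gcoeff_a_inv:
  assumes "f \<in> carrier (grassmann R n)" "\<gamma> \<subseteq> {1..n}"
  shows "(\<ominus>\<^bsub>grassmann R n\<^esub> f) \<gamma> = \<ominus> f \<gamma>"
proof -
  interpret L: ring "grassmann R n" by (rule ring_grassmann)
  have "(\<ominus>\<^bsub>grassmann R n\<^esub> f \<oplus>\<^bsub>grassmann R n\<^esub> f) \<gamma> = \<zero>"
    using assms by (simp add: L.l_neg)
  then show ?thesis
    using assms L.a_inv_closed[OF assms(1)] by (metis gcoeff_add gcoeff_closed minus_equality)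
qed

lemma gcoeff_finsum:
  assumes "finite A" "F \<in> A \<rightarrow> carrier (grassmann R n)" "\<gamma> \<subseteq> {1..n}"
  shows "(\<Oplus>\<^bsub>grassmann R n\<^esub>a\<in>A. F a) \<gamma> = (\<Oplus>a\<in>A. F a \<gamma>)"
proof -
  interpret L: ring "grassmann R n" by (rule ring_grassmann)
  show ?thesis
    using assms(1,2)
  proof (induction A rule: finite_induct)
    case empty
    then show ?case using assms by simp
  next
    case (insert x A)
    then have F: "F \<in> A \<rightarrow> carrier (grassmann R n)" "F x \<in> carrier (grassmann R n)" by auto
    then have "(\<lambda>a. F a \<gamma>) \<in> A \<rightarrow> carrier R"
      using gcoeff_closed[OF _ assms(3)] by blast
    with insert F assms(3) show ?case
      by (simp add: L.finsum_insert finsum_insert)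
  qed
qed

text \<open>The defining relations of the Grassmann ring, and freeness over \<open>K\<close> on the monomials
  (the coefficients of an element are unique because an element is its coefficient family).\<close>

lemma gconst_gvar_commute:
  assumes "k \<in> carrier R" "i \<in> {1..n}"
  shows "gconst R n k \<otimes>\<^bsub>grassmann R n\<^esub> gvar R n i = gvar R n i \<otimes>\<^bsub>grassmann R n\<^esub> gconst R n k"
proof (rule gcoeff_eqI[of _ n])
  show "gconst R n k \<otimes>\<^bsub>grassmann R n\<^esub> gvar R n i \<in> carrier (grassmann R n)"
    "gvar R n i \<otimes>\<^bsub>grassmann R n\<^esub> gconst R n k \<in> carrier (grassmann R n)"
    using assms by (auto intro!: gmult_closed gconst_closed gvar_closed)
  fix \<gamma> :: "nat set" assume \<gamma>: "\<gamma> \<subseteq> {1..n}"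
  then show "(gconst R n k \<otimes>\<^bsub>grassmann R n\<^esub> gvar R n i) \<gamma> = (gvar R n i \<otimes>\<^bsub>grassmann R n\<^esub> gconst R n k) \<gamma>"
    using assms by (simp add: gcoeff_const_mult gcoeff_mult_const gvar_closed) (simp add: gvar_def)
qed

lemma gvar_square:
  assumes "i \<in> {1..n}"
  shows "gvar R n i \<otimes>\<^bsub>grassmann R n\<^esub> gvar R n i = \<zero>\<^bsub>grassmann R n\<^esub>"
proof (rule gcoeff_eqI[of _ n])
  show "gvar R n i \<otimes>\<^bsub>grassmann R n\<^esub> gvar R n i \<in> carrier (grassmann R n)"
    by (intro gmult_closed gvar_closed)
  fix \<gamma> :: "nat set" assume \<gamma>: "\<gamma> \<subseteq> {1..n}"
  then have "gvar R n i (\<gamma> - {i}) = \<zero>" by (auto simp: gvar_def)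
  then show "(gvar R n i \<otimes>\<^bsub>grassmann R n\<^esub> gvar R n i) \<gamma> = \<zero>\<^bsub>grassmann R n\<^esub> \<gamma>"
    using assms \<gamma> by (simp add: gcoeff_var_mult gvar_closed)
qed (rule gzero_closed)

lemma gvar_anticommute:
  assumes "i \<in> {1..n}" "j \<in> {1..n}" "i \<noteq> j"
  shows "gvar R n i \<otimes>\<^bsub>grassmann R n\<^esub> gvar R n j =
    \<ominus>\<^bsub>grassmann R n\<^esub> (gvar R n j \<otimes>\<^bsub>grassmann R n\<^esub> gvar R n i)"
proof -
  interpret L: ring "grassmann R n" by (rule ring_grassmann)
  show ?thesis
  proof (rule gcoeff_eqI[of _ n])
    show "gvar R n i \<otimes>\<^bsub>grassmann R n\<^esub> gvar R n j \<in> carrier (grassmann R n)"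
      "\<ominus>\<^bsub>grassmann R n\<^esub> (gvar R n j \<otimes>\<^bsub>grassmann R n\<^esub> gvar R n i) \<in> carrier (grassmann R n)"
      by (auto intro!: gmult_closed gvar_closed)
    fix \<gamma> :: "nat set" assume \<gamma>: "\<gamma> \<subseteq> {1..n}"
    have I: "even (inversions {i} {j}) = odd (inversions {j} {i})"
      using inversions_single[of "{i}" j] assms(3) by (auto simp: even_add dest: arg_cong[where f = even])
    have P: "(gvar R n p \<otimes>\<^bsub>grassmann R n\<^esub> gvar R n q) \<gamma> =
        (if \<gamma> = {i, j} then gsign (inversions {p} {q}) \<one> else \<zero>)" if "{p, q} = {i, j}" for p q
    proof -
      have pq: "p \<in> {1..n}" "q \<in> {1..n}" "p \<noteq> q"
        using that assms by (auto simp: doubleton_eq_iff)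
      have 1: "(p \<in> \<gamma> \<and> \<gamma> - {p} = {q}) = (\<gamma> = {i, j})"
        unfolding that[symmetric] using pq(3) insert_Diff[of p \<gamma>] by (metis Diff_insert_absorb insertI1 singletonD)
      have 2: "\<gamma> - {p} \<subseteq> {1..n}" using \<gamma> by auto
      show ?thesis
        proof (cases "p \<in> \<gamma> \<and> \<gamma> - {p} = {q}")
        case True
        moreover have "gvar R n q {q} = \<one>" using pq by (simp add: gvar_def)
        ultimately show ?thesis
          unfolding gcoeff_var_mult[OF pq(1) gvar_closed \<gamma>] 1[symmetric] by simp
      next
        case False
        moreover have "gvar R n q (\<gamma> - {p}) = (if \<gamma> - {p} = {q} then \<one> else \<zero>)"
          using 2 unfolding gvar_def by (simp only: restrict_apply' Pow_iff)
        ultimately show ?thesis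
          unfolding gcoeff_var_mult[OF pq(1) gvar_closed \<gamma>] 1[symmetric] by (simp split: if_splits)
      qed
    qed
    show "(gvar R n i \<otimes>\<^bsub>grassmann R n\<^esub> gvar R n j) \<gamma> =
        (\<ominus>\<^bsub>grassmann R n\<^esub> (gvar R n j \<otimes>\<^bsub>grassmann R n\<^esub> gvar R n i)) \<gamma>"
      using I by (simp add: gcoeff_a_inv[OF gmult_closed[OF gvar_closed gvar_closed] \<gamma>] P insert_commute
          gsign_eq minus_minus)
  qed
qed

lemma gcoeff_monom:
  assumes "\<alpha> \<subseteq> {1..n}" "\<gamma> \<subseteq> {1..n}"
  shows "gmonom R n \<alpha> \<gamma> = (if \<gamma> = \<alpha> then \<one> else \<zero>)"
proof -
  let ?m = "\<lambda>xs. foldr (\<lambda>i m. gvar R n i \<otimes>\<^bsub>grassmann R n\<^esub> m) xs \<one>\<^bsub>grassmann R n\<^esub>"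
  have cl: "?m xs \<in> carrier (grassmann R n)" for xs
    by (induction xs) (auto intro: gmult_closed gvar_closed gone_closed)
  have "?m xs \<gamma> = (if \<gamma> = set xs then \<one> else \<zero>)"
    if "sorted_wrt (<) xs" "set xs \<subseteq> {1..n}" "\<gamma> \<subseteq> {1..n}" for xs \<gamma>
    using that
  proof (induction xs arbitrary: \<gamma>)
    case Nil
    then show ?case by simp
  next
    case (Cons i xs)
    then have i: "i \<in> {1..n}" "i \<notin> set xs" by auto
    have g: "\<gamma> - {i} \<subseteq> {1..n}" using Cons.prems by auto
    have IH: "?m xs (\<gamma> - {i}) = (if \<gamma> - {i} = set xs then \<one> else \<zero>)"
      using Cons g by auto
    have I: "inversions {i} (set xs) = 0"
      using Cons.prems by (intro inversions_le) (auto intro: less_imp_le)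
    have E: "i \<in> \<gamma> \<and> \<gamma> - {i} = set xs \<longleftrightarrow> \<gamma> = set (i # xs)" using i by auto
    have "?m (i # xs) \<gamma> = (if i \<in> \<gamma> then gsign (inversions {i} (\<gamma> - {i})) (?m xs (\<gamma> - {i})) else \<zero>)"
      using gcoeff_var_mult[OF i(1) cl Cons.prems(3)] by simp
    also have "\<dots> = (if \<gamma> = set (i # xs) then \<one> else \<zero>)"
      unfolding IH E[symmetric] by (auto simp: I)
    finally show ?case .
  qed
  moreover have "finite \<alpha>" using assms finite_subset by blast
  ultimately show ?thesis using assms by (simp add: gmonom_def)
qed

lemma gmonom_closed: "gmonom R n \<alpha> \<in> carrier (grassmann R n)"
proof -
  have "foldr (\<lambda>i m. gvar R n i \<otimes>\<^bsub>grassmann R n\<^esub> m) xs \<one>\<^bsub>grassmann R n\<^esub> \<in> carrier (grassmann R n)" for xs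
    by (induction xs) (auto intro: gmult_closed gvar_closed gone_closed)
  then show ?thesis by (simp add: gmonom_def)
qed

lemma grassmann_expansion:
  assumes "f \<in> carrier (grassmann R n)"
  shows "f = (\<Oplus>\<^bsub>grassmann R n\<^esub>\<alpha>\<in>Pow {1..n}. gconst R n (f \<alpha>) \<otimes>\<^bsub>grassmann R n\<^esub> gmonom R n \<alpha>)"
proof -
  interpret L: ring "grassmann R n" by (rule ring_grassmann)
  have T: "(\<lambda>\<alpha>. gconst R n (f \<alpha>) \<otimes>\<^bsub>grassmann R n\<^esub> gmonom R n \<alpha>) \<in> Pow {1..n} \<rightarrow> carrier (grassmann R n)"
    using assms by (auto intro!: gmult_closed gconst_closed gmonom_closed)
  show ?thesis
  proof (rule gcoeff_eqI[of _ n])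
    fix \<gamma> :: "nat set" assume \<gamma>: "\<gamma> \<subseteq> {1..n}"
    have "(\<Oplus>\<^bsub>grassmann R n\<^esub>\<alpha>\<in>Pow {1..n}. gconst R n (f \<alpha>) \<otimes>\<^bsub>grassmann R n\<^esub> gmonom R n \<alpha>) \<gamma> =
        (\<Oplus>\<alpha>\<in>Pow {1..n}. (gconst R n (f \<alpha>) \<otimes>\<^bsub>grassmann R n\<^esub> gmonom R n \<alpha>) \<gamma>)"
      by (rule gcoeff_finsum) (use T \<gamma> in auto)
    also have "\<dots> = (\<Oplus>\<alpha>\<in>Pow {1..n}. if \<alpha> = \<gamma> then f \<alpha> else \<zero>)"
      by (intro finsum_cong' refl)
        (use assms \<gamma> in \<open>auto simp: gcoeff_const_mult gmonom_closed gcoeff_monom\<close>)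
    also have "\<dots> = f \<gamma>"
      using assms \<gamma> by (intro add.finprod_singleton_swap) auto
    finally show "f \<gamma> = (\<Oplus>\<^bsub>grassmann R n\<^esub>\<alpha>\<in>Pow {1..n}. gconst R n (f \<alpha>) \<otimes>\<^bsub>grassmann R n\<^esub> gmonom R n \<alpha>) \<gamma>"
      by simp
  qed (use assms T L.finsum_closed in auto)
qed

lemma gcomponent_closed: "b \<in> gcomponent R n d \<Longrightarrow> b \<in> carrier (grassmann R n)"
  by (simp add: gcomponent_def)

lemma gconst_component: "k \<in> carrier R \<Longrightarrow> gconst R n k \<in> gcomponent R n 0"
  unfolding gcomponent_def using gconst_closed by (auto simp: gconst_def)

lemma gvar_component: "gvar R n i \<in> gcomponent R n 1"
  unfolding gcomponent_def using gvar_closed by (auto simp: gvar_def)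

lemma finsum_Pow_insert:
  assumes "finite G" "i \<notin> G" and F: "F \<in> Pow (insert i G) \<rightarrow> carrier R"
  shows "finsum R F (Pow (insert i G)) = (\<Oplus>A\<in>Pow G. F A \<oplus> F (insert i A))"
proof -
  have P: "Pow (insert i G) = Pow G \<union> insert i ` Pow G" by (rule Pow_insert)
  have inj: "inj_on (insert i) (Pow G)" using assms(2) by (auto simp: inj_on_def)
  have F': "F \<in> Pow G \<rightarrow> carrier R" "F \<in> insert i ` Pow G \<rightarrow> carrier R"
    "(\<lambda>A. F (insert i A)) \<in> Pow G \<rightarrow> carrier R"
    using F unfolding P by auto
  have "finsum R F (Pow (insert i G)) = finsum R F (Pow G) \<oplus> finsum R F (insert i ` Pow G)"
    unfolding P by (rule finsum_Un_disjoint) (use assms F' in auto)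
  also have "finsum R F (insert i ` Pow G) = (\<Oplus>A\<in>Pow G. F (insert i A))"
    by (rule finsum_reindex[OF F'(2) inj])
  finally show ?thesis using F' by (simp add: finsum_addf)
qed

lemma left_skew_partial_exists:
  assumes i: "i \<in> {1..n}"
  shows "is_left_skew_partial R n i
    (\<lambda>f. \<lambda>\<gamma>\<in>Pow {1..n}. if i \<in> \<gamma> then \<zero> else gsign (inversions {i} \<gamma>) (f (insert i \<gamma>)))"
   
proof -
  define D where "D = (\<lambda>f. \<lambda>\<gamma>\<in>Pow {1..n}. if i \<in> \<gamma> then \<zero> else gsign (inversions {i} \<gamma>) (f (insert i \<gamma>)))"
  interpret L: ring "grassmann R n" by (rule ring_grassmann)
  have ins: "insert i \<gamma> \<subseteq> {1..n}" if "\<gamma> \<subseteq> {1..n}" for \<gamma>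
    using that i by auto
  have De: "D f \<gamma> = (if i \<in> \<gamma> then \<zero> else gsign (inversions {i} \<gamma>) (f (insert i \<gamma>)))"
    if "\<gamma> \<subseteq> {1..n}" for f \<gamma>
    using that by (simp add: D_def)
  have Dc: "D f \<in> carrier (grassmann R n)" if "f \<in> carrier (grassmann R n)" for f
  proof -
    have "D f \<gamma> \<in> carrier R" if "\<gamma> \<subseteq> {1..n}" for \<gamma>
      unfolding De[OF that] using gcoeff_closed[OF \<open>f \<in> _\<close> ins[OF that]] by simp
    moreover have "D f \<in> extensional (Pow {1..n})" by (simp add: D_def)
    ultimately show ?thesis unfolding gcarrier PiE_iff by blast
  qed
  have add: "D (b \<oplus>\<^bsub>grassmann R n\<^esub> c) = D b \<oplus>\<^bsub>grassmann R n\<^esub> D c"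
    if b: "b \<in> carrier (grassmann R n)" and c: "c \<in> carrier (grassmann R n)" for b c
  proof (rule gcoeff_eqI[of _ n])
    fix \<gamma> :: "nat set" assume \<gamma>: "\<gamma> \<subseteq> {1..n}"
    show "D (b \<oplus>\<^bsub>grassmann R n\<^esub> c) \<gamma> = (D b \<oplus>\<^bsub>grassmann R n\<^esub> D c) \<gamma>"
      unfolding gcoeff_add[OF \<gamma>] De[OF \<gamma>] gcoeff_add[OF ins[OF \<gamma>]]
      using gcoeff_closed[OF b ins[OF \<gamma>]] gcoeff_closed[OF c ins[OF \<gamma>]] by (simp add: gsign_add)
  qed (use b c Dc gadd_closed in auto)
  have const: "D (gconst R n k) = \<zero>\<^bsub>grassmann R n\<^esub>" if "k \<in> carrier R" for k
  proof (rule gcoeff_eqI[of _ n])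
    fix \<gamma> :: "nat set" assume \<gamma>: "\<gamma> \<subseteq> {1..n}"
    have "gconst R n k (insert i \<gamma>) = \<zero>"
      using ins[OF \<gamma>] by (auto simp: gconst_def)
    then show "D (gconst R n k) \<gamma> = \<zero>\<^bsub>grassmann R n\<^esub> \<gamma>"
      unfolding De[OF \<gamma>] gcoeff_zero[OF \<gamma>] by simp
  qed (use that Dc gconst_closed gzero_closed in auto)
  have var: "D (gvar R n j) = (if j = i then \<one>\<^bsub>grassmann R n\<^esub> else \<zero>\<^bsub>grassmann R n\<^esub>)" for j
  proof (rule gcoeff_eqI[of _ n])
    fix \<gamma> :: "nat set" assume \<gamma>: "\<gamma> \<subseteq> {1..n}"
    have "gvar R n j (insert i \<gamma>) = (if j = i \<and> \<gamma> = {} then \<one> else \<zero>)" if "i \<notin> \<gamma>"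
    proof -
      have "insert i \<gamma> = {j} \<longleftrightarrow> j = i \<and> \<gamma> = {}" using that by auto
      then show ?thesis using ins[OF \<gamma>] unfolding gvar_def by (simp only: restrict_apply' Pow_iff)
    qed
    then show "D (gvar R n j) \<gamma> = (if j = i then \<one>\<^bsub>grassmann R n\<^esub> else \<zero>\<^bsub>grassmann R n\<^esub>) \<gamma>"
      using \<gamma> unfolding De[OF \<gamma>] by (cases "\<gamma> = {}") auto
  qed (use Dc gvar_closed gzero_closed gone_closed in auto)
  have leib: "D (b \<otimes>\<^bsub>grassmann R n\<^esub> c) = (D b \<otimes>\<^bsub>grassmann R n\<^esub> c) \<oplus>\<^bsub>grassmann R n\<^esub>
      ((\<ominus>\<^bsub>grassmann R n\<^esub> \<one>\<^bsub>grassmann R n\<^esub>) [^]\<^bsub>grassmann R n\<^esub> d \<otimes>\<^bsub>grassmann R n\<^esub> b \<otimes>\<^bsub>grassmann R n\<^esub> D c)"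
    if bd: "b \<in> gcomponent R n d" and c: "c \<in> carrier (grassmann R n)" for b c d
  proof (rule gcoeff_eqI[of _ n])
    have b: "b \<in> carrier (grassmann R n)" using bd by (rule gcomponent_closed)
    have bz: "b A = \<zero>" if "A \<subseteq> {1..n}" "card A \<noteq> d" for A
      using bd that by (auto simp: gcomponent_def)
    let ?m = "(\<ominus>\<^bsub>grassmann R n\<^esub> \<one>\<^bsub>grassmann R n\<^esub>) [^]\<^bsub>grassmann R n\<^esub> d"
    have meq: "?m \<otimes>\<^bsub>grassmann R n\<^esub> b = L.gsign d b" by (simp add: L.gsign_def)
    have mb: "(?m \<otimes>\<^bsub>grassmann R n\<^esub> b) A = gsign d (b A)" if "A \<subseteq> {1..n}" for A
      unfolding meq L.gsign_eq[OF b] using gcoeff_closed[OF b that]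
      by (simp add: gsign_eq gcoeff_a_inv[OF b that])
    have mbc: "?m \<otimes>\<^bsub>grassmann R n\<^esub> b \<in> carrier (grassmann R n)"
      unfolding meq using b by simp
    show "D (b \<otimes>\<^bsub>grassmann R n\<^esub> c) \<in> carrier (grassmann R n)"
      by (intro Dc gmult_closed b c)
    show "(D b \<otimes>\<^bsub>grassmann R n\<^esub> c) \<oplus>\<^bsub>grassmann R n\<^esub> (?m \<otimes>\<^bsub>grassmann R n\<^esub> b \<otimes>\<^bsub>grassmann R n\<^esub> D c)
        \<in> carrier (grassmann R n)"
      by (intro Dc gmult_closed gadd_closed mbc b c)
    fix \<gamma> :: "nat set" assume \<gamma>: "\<gamma> \<subseteq> {1..n}"
    have fin: "finite \<gamma>" using \<gamma> finite_subset by blast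
    have fs: "finite A" if "A \<subseteq> \<gamma>" for A using that fin finite_subset by blast
    have sub: "A \<subseteq> {1..n}" if "A \<subseteq> \<gamma>" for A using that \<gamma> by auto
    note rhs = gcoeff_add[OF \<gamma>] gcoeff_mult[OF \<gamma>]
    show "D (b \<otimes>\<^bsub>grassmann R n\<^esub> c) \<gamma> = ((D b \<otimes>\<^bsub>grassmann R n\<^esub> c) \<oplus>\<^bsub>grassmann R n\<^esub>
        (?m \<otimes>\<^bsub>grassmann R n\<^esub> b \<otimes>\<^bsub>grassmann R n\<^esub> D c)) \<gamma>"
    proof (cases "i \<in> \<gamma>")
      case True
      define G where "G = \<gamma> - {i}"
      have G: "\<gamma> = insert i G" "i \<notin> G" "G \<subseteq> {1..n}" using True \<gamma> by (auto simp: G_def)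
      have finG: "finite G" using fin by (simp add: G_def)
      have bc: "b (insert i A) \<in> carrier R" "b A \<in> carrier R" "c (insert i A) \<in> carrier R" "c A \<in> carrier R"
        if "A \<subseteq> G" for A
        using that G(3) by (auto intro!: gcoeff_closed[OF b] gcoeff_closed[OF c] ins)
      have D0: "D F (insert i A) = \<zero>" if "A \<subseteq> G" for A F
        using De[OF ins, of A F] that G(3) by auto
      have D1: "D F A = gsign (inversions {i} A) (F (insert i A))" if "A \<subseteq> G" for A F
        using De[of A F] that G(2,3) by auto
      let ?f = "\<lambda>\<alpha>. gsign (inversions \<alpha> (\<gamma> - \<alpha>)) (D b \<alpha> \<otimes> c (\<gamma> - \<alpha>))"
      let ?g = "\<lambda>\<alpha>. gsign (inversions \<alpha> (\<gamma> - \<alpha>)) ((?m \<otimes>\<^bsub>grassmann R n\<^esub> b) \<alpha> \<otimes> D c (\<gamma> - \<alpha>))"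
      have closed: "?f \<in> Pow \<gamma> \<rightarrow> carrier R" "?g \<in> Pow \<gamma> \<rightarrow> carrier R"
        using gterm_closed[OF Dc[OF b] c \<gamma>] gterm_closed[OF mbc Dc[OF c] \<gamma>]
        by (blast intro: gsign_closed)+
      have "(finsum R ?f (Pow \<gamma>)) \<oplus> (finsum R ?g (Pow \<gamma>)) = (\<Oplus>\<alpha>\<in>Pow \<gamma>. ?f \<alpha> \<oplus> ?g \<alpha>)"
        using closed by (rule finsum_addf[symmetric])
      also have "\<dots> = (\<Oplus>A\<in>Pow G. (?f A \<oplus> ?g A) \<oplus> (?f (insert i A) \<oplus> ?g (insert i A)))"
        unfolding G(1) by (rule finsum_Pow_insert) (use finG G(2) closed in \<open>auto simp: G(1)[symmetric] Pi_iff\<close>)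
      also have "\<dots> = \<zero>"
      proof (rule add.finprod_one_eqI)
        fix A assume "A \<in> Pow G"
        then have A: "A \<subseteq> G" by simp
        have fA: "finite A" "i \<notin> A" "finite (G - A)" using A finG G(2) finite_subset by auto
        have d1: "\<gamma> - A = insert i (G - A)" "\<gamma> - insert i A = G - A" using A G by auto
        have An: "A \<subseteq> {1..n}" "insert i A \<subseteq> {1..n}" using A G i by auto
        have 1: "inversions A ({i} \<union> (G - A)) = inversions A {i} + inversions A (G - A)"
          by (rule inversions_Un_right) (use fA G in auto)
        have 2: "inversions ({i} \<union> A) (G - A) = inversions {i} (G - A) + inversions A (G - A)"
          by (rule inversions_Un_left) (use fA G in auto)
        note c1 = bc(1)[OF A] bc(2)[OF A] bc(3)[of "G - A"] bc(4)[of "G - A"]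
        have z: "?g A = \<zero>" "?f (insert i A) = \<zero>"
          using c1 A unfolding d1 D0[OF A] mb[OF An(1)] by (simp_all add: D0)
        define X where "X = b (insert i A) \<otimes> c (insert i (G - A))"
        have X: "X \<in> carrier R" unfolding X_def using c1 A by auto
        have fe: "?f A = gsign (inversions A ({i} \<union> (G - A)) + inversions {i} A) X"
          unfolding d1 D1[OF A] X_def using c1 by (simp add: gsign_mult_left gsign_gsign)
        have ge: "?g (insert i A) = gsign (inversions ({i} \<union> A) (G - A) + (d + inversions {i} (G - A))) X"
          unfolding d1 mb[OF An(2)] X_def D1[of "G - A" c, simplified] using c1
          by (simp add: gsign_mult_left gsign_mult_right gsign_gsign add.commute[of d])
        have "?f A \<oplus> ?g (insert i A) = \<zero>"
        proof (cases "card (insert i A) = d")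
          case True
          then have "d = Suc (card A)" using fA by simp
          then have "even (inversions A ({i} \<union> (G - A)) + inversions {i} A) \<longleftrightarrow>
              odd (inversions ({i} \<union> A) (G - A) + (d + inversions {i} (G - A)))"
            unfolding 1 2 inversions_single[OF fA(1,2), symmetric] by auto
          then show ?thesis unfolding fe ge using X by (auto simp: gsign_eq r_neg l_neg)
        next
          case False
          then have "X = \<zero>" unfolding X_def using bz[OF An(2)] c1 by simp
          then show ?thesis unfolding fe ge by simp
        qed
        moreover have "?f A \<in> carrier R" "?g (insert i A) \<in> carrier R"
          unfolding fe ge using X by auto
        ultimately show "(?f A \<oplus> ?g A) \<oplus> (?f (insert i A) \<oplus> ?g (insert i A)) = \<zero>"
          unfolding z by simp
      qed
      finally show ?thesis unfolding rhs using De[OF \<gamma>] True by simp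
    next
      case False
      have bc: "b (insert i A) \<in> carrier R" "b A \<in> carrier R" "c (insert i A) \<in> carrier R" "c A \<in> carrier R"
        if "A \<subseteq> \<gamma>" for A
        using that \<gamma> by (auto intro!: gcoeff_closed[OF b] gcoeff_closed[OF c] ins)
      have D1: "D F A = gsign (inversions {i} A) (F (insert i A))" if "A \<subseteq> \<gamma>" for A F
        using De[of A F] that False \<gamma> by auto
      let ?f = "\<lambda>\<alpha>. gsign (inversions \<alpha> (\<gamma> - \<alpha>)) (D b \<alpha> \<otimes> c (\<gamma> - \<alpha>))"
      let ?g = "\<lambda>\<alpha>. gsign (inversions \<alpha> (\<gamma> - \<alpha>)) ((?m \<otimes>\<^bsub>grassmann R n\<^esub> b) \<alpha> \<otimes> D c (\<gamma> - \<alpha>))"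
      let ?h = "\<lambda>\<alpha>. gsign (inversions {i} \<gamma>) (gsign (inversions \<alpha> (insert i \<gamma> - \<alpha>)) (b \<alpha> \<otimes> c (insert i \<gamma> - \<alpha>)))"
      have closed: "?f \<in> Pow \<gamma> \<rightarrow> carrier R" "?g \<in> Pow \<gamma> \<rightarrow> carrier R" "?h \<in> Pow (insert i \<gamma>) \<rightarrow> carrier R"
        using gterm_closed[OF Dc[OF b] c \<gamma>] gterm_closed[OF mbc Dc[OF c] \<gamma>] gterm_closed[OF b c ins[OF \<gamma>]]
        by (blast intro: gsign_closed)+
      have "D (b \<otimes>\<^bsub>grassmann R n\<^esub> c) \<gamma> = finsum R ?h (Pow (insert i \<gamma>))"
        unfolding D1[OF subset_refl] gcoeff_mult[OF ins[OF \<gamma>]]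
        by (rule gsign_finsum) (use fin gterm_closed[OF b c ins[OF \<gamma>]] in \<open>auto intro!: gsign_closed\<close>)
      also have "\<dots> = (\<Oplus>A\<in>Pow \<gamma>. ?h A \<oplus> ?h (insert i A))"
        by (rule finsum_Pow_insert[OF fin False closed(3)])
      also have "\<dots> = (\<Oplus>A\<in>Pow \<gamma>. ?f A \<oplus> ?g A)"
      proof (rule finsum_cong'[OF refl])
        show "(\<lambda>A. ?f A \<oplus> ?g A) \<in> Pow \<gamma> \<rightarrow> carrier R"
          using closed(1,2) by (blast intro: a_closed)
        fix A assume "A \<in> Pow \<gamma>"
        then have A: "A \<subseteq> \<gamma>" by simp
        have fA: "finite A" "i \<notin> A" "finite (\<gamma> - A)" using A fin False finite_subset by auto
        have d1: "insert i \<gamma> - A = insert i (\<gamma> - A)" "insert i \<gamma> - insert i A = \<gamma> - A" using A False by auto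
        have An: "A \<subseteq> {1..n}" using A \<gamma> by auto
        have 1: "inversions A ({i} \<union> (\<gamma> - A)) = inversions A {i} + inversions A (\<gamma> - A)"
          by (rule inversions_Un_right) (use fA False in auto)
        have 2: "inversions ({i} \<union> A) (\<gamma> - A) = inversions {i} (\<gamma> - A) + inversions A (\<gamma> - A)"
          by (rule inversions_Un_left) (use fA False in auto)
        have "inversions {i} (A \<union> (\<gamma> - A)) = inversions {i} A + inversions {i} (\<gamma> - A)"
          by (rule inversions_Un_right) (use fA in auto)
        moreover have "A \<union> (\<gamma> - A) = \<gamma>" using A by auto
        ultimately have 3: "inversions {i} \<gamma> = inversions {i} A + inversions {i} (\<gamma> - A)" by simp
        note c1 = bc(1)[OF A] bc(2)[OF A] bc(3)[of "\<gamma> - A"] bc(4)[of "\<gamma> - A"]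
        define X where "X = b (insert i A) \<otimes> c (\<gamma> - A)"
        define Y where "Y = b A \<otimes> c (insert i (\<gamma> - A))"
        have X: "X \<in> carrier R" and Y: "Y \<in> carrier R" unfolding X_def Y_def using c1 by auto
        have f: "?f A = gsign (inversions A (\<gamma> - A) + inversions {i} A) X"
          unfolding D1[OF A] X_def using c1 by (simp add: gsign_mult_left gsign_gsign)
        have g: "?g A = gsign (inversions A (\<gamma> - A) + (d + inversions {i} (\<gamma> - A))) Y"
          unfolding mb[OF An] Y_def D1[of "\<gamma> - A" c, simplified] using c1
          by (simp add: gsign_mult_left gsign_mult_right gsign_gsign add.commute[of d])
        have h: "?h (insert i A) = gsign (inversions {i} \<gamma> + inversions ({i} \<union> A) (\<gamma> - A)) X"
          "?h A = gsign (inversions {i} \<gamma> + inversions A ({i} \<union> (\<gamma> - A))) Y"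
          unfolding d1 X_def Y_def using c1 by (simp_all add: gsign_gsign)
        have hf: "?h (insert i A) = ?f A"
          unfolding h f by (rule gsign_cong[OF X]) (unfold 2 3, auto)
        have hg: "?h A = ?g A"
        proof (cases "card A = d")
          case True
          then show ?thesis unfolding h g
            by (intro gsign_cong[OF Y]) (use inversions_single[OF fA(1,2)] in \<open>unfold 1 3, presburger\<close>)
        next
          case False
          then have "Y = \<zero>" unfolding Y_def using bz[OF An] c1 by simp
          then show ?thesis unfolding h g by simp
        qed
        show "?h A \<oplus> ?h (insert i A) = ?f A \<oplus> ?g A"
          unfolding hf hg using f g X Y by (simp add: a_comm)
      qed
      also have "\<dots> = finsum R ?f (Pow \<gamma>) \<oplus> finsum R ?g (Pow \<gamma>)"
        by (rule finsum_addf[OF closed(1,2)])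
      finally show ?thesis unfolding rhs .
    qed
  qed
  show ?thesis
    unfolding D_def[symmetric] is_left_skew_partial_def
    by (intro conjI ballI allI funcsetI) (erule Dc, erule (1) add, erule const, rule var, erule (1) leib)
qed

lemma left_skew_partial_unique:
  assumes D: "is_left_skew_partial R n i D" and E: "is_left_skew_partial R n i E"
    and f: "f \<in> carrier (grassmann R n)"
  shows "D f = E f"
proof -
  interpret L: ring "grassmann R n" by (rule ring_grassmann)
  have P: "F b \<in> carrier (grassmann R n)"
    "F (b \<oplus>\<^bsub>grassmann R n\<^esub> c) = F b \<oplus>\<^bsub>grassmann R n\<^esub> F c"
    if "is_left_skew_partial R n i F" "b \<in> carrier (grassmann R n)" "c \<in> carrier (grassmann R n)" for F b c
    using that by (auto simp: is_left_skew_partial_def)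
  have Q: "F (gconst R n k) = \<zero>\<^bsub>grassmann R n\<^esub>"
    if "is_left_skew_partial R n i F" "k \<in> carrier R" for F k
    using that by (auto simp: is_left_skew_partial_def)
  have V: "F (gvar R n j) = (if j = i then \<one>\<^bsub>grassmann R n\<^esub> else \<zero>\<^bsub>grassmann R n\<^esub>)"
    if "is_left_skew_partial R n i F" "j \<in> {1..n}" for F j
    using that unfolding is_left_skew_partial_def by blast
  have M: "F (b \<otimes>\<^bsub>grassmann R n\<^esub> c) = (F b \<otimes>\<^bsub>grassmann R n\<^esub> c) \<oplus>\<^bsub>grassmann R n\<^esub>
      ((\<ominus>\<^bsub>grassmann R n\<^esub> \<one>\<^bsub>grassmann R n\<^esub>) [^]\<^bsub>grassmann R n\<^esub> d \<otimes>\<^bsub>grassmann R n\<^esub> b \<otimes>\<^bsub>grassmann R n\<^esub> F c)"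
    if "is_left_skew_partial R n i F" "b \<in> gcomponent R n d" "c \<in> carrier (grassmann R n)" for F b c d
    using that unfolding is_left_skew_partial_def by blast
  let ?m = "\<lambda>xs. foldr (\<lambda>i m. gvar R n i \<otimes>\<^bsub>grassmann R n\<^esub> m) xs \<one>\<^bsub>grassmann R n\<^esub>"
  have cl: "?m xs \<in> carrier (grassmann R n)" for xs
    by (induction xs) (auto intro: gmult_closed gvar_closed)
  have "D (?m xs) = E (?m xs)" if "set xs \<subseteq> {1..n}" for xs
    using that
  proof (induction xs)
    case Nil
    show ?case using Q[OF D, of \<one>] Q[OF E, of \<one>] by (simp add: gone_eq)
  next
    case (Cons j xs)
    then show ?case
      using M[OF D gvar_component cl] M[OF E gvar_component cl] V[OF D] V[OF E] by simp
  qed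
  then have mon: "D (gmonom R n \<alpha>) = E (gmonom R n \<alpha>)" if "\<alpha> \<subseteq> {1..n}" for \<alpha>
    using that finite_subset[OF that] by (simp add: gmonom_def)
  let ?t = "\<lambda>\<alpha>. gconst R n (f \<alpha>) \<otimes>\<^bsub>grassmann R n\<^esub> gmonom R n \<alpha>"
  have tc: "?t \<alpha> \<in> carrier (grassmann R n)" if "\<alpha> \<subseteq> {1..n}" for \<alpha>
    using f that by (auto intro!: gmult_closed gconst_closed gmonom_closed)
  have t: "D (?t \<alpha>) = E (?t \<alpha>)" if "\<alpha> \<subseteq> {1..n}" for \<alpha>
    using M[OF D gconst_component gmonom_closed] M[OF E gconst_component gmonom_closed]
      Q[OF D] Q[OF E] mon[OF that] gcoeff_closed[OF f that] by simp
  have "D (finsum (grassmann R n) ?t S) = E (finsum (grassmann R n) ?t S)"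
    if "finite S" "S \<subseteq> Pow {1..n}" for S
    using that
  proof (induction S rule: finite_induct)
    case empty
    have "gconst R n \<zero> = \<zero>\<^bsub>grassmann R n\<^esub>"
      by (simp add: grassmann_def gconst_def cong: if_cong)
    then show ?case using Q[OF D, of \<zero>] Q[OF E, of \<zero>] by (simp add: L.finsum_empty)
  next
    case (insert x S)
    then have c: "?t \<in> S \<rightarrow> carrier (grassmann R n)" "?t x \<in> carrier (grassmann R n)"
      using tc by auto
    show ?case
      unfolding L.finsum_insert[OF insert(1,2) c]
      using P(2)[OF D c(2) L.finsum_closed[OF c(1)]] P(2)[OF E c(2) L.finsum_closed[OF c(1)]]
        t[of x] insert by simp
  qed
  from this[of "Pow {1..n}"] show ?thesis
    using grassmann_expansion[OF f] by simp
qed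

theorem ex1_left_skew_partial:
  assumes "i \<in> {1..n}"
  shows "\<exists>!D. D \<in> extensional (carrier (grassmann R n)) \<and> is_left_skew_partial R n i D"
proof -
  interpret L: ring "grassmann R n" by (rule ring_grassmann)
  obtain D where D: "is_left_skew_partial R n i D"
    using left_skew_partial_exists[OF assms] by blast
  let ?D = "restrict D (carrier (grassmann R n))"
  have rD: "is_left_skew_partial R n i ?D"
    using D gconst_closed gvar_closed gcomponent_closed
    unfolding is_left_skew_partial_def by (simp add: Pi_iff)
  show ?thesis
  proof (intro ex1I[of _ ?D] conjI)
    fix E assume E: "E \<in> extensional (carrier (grassmann R n)) \<and> is_left_skew_partial R n i E"
    show "E = ?D"
      by (rule extensionalityI[of _ "carrier (grassmann R n)"])
        (use E rD left_skew_partial_unique in auto)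
  qed (use rD in auto)
qed

lemma gpartial_is_left_skew_partial:
  assumes "i \<in> {1..n}"
  shows "is_left_skew_partial R n i (gpartial R n i)"
  unfolding gpartial_def using theI'[OF ex1_left_skew_partial[OF assms]] by blast

end

end

theory Submission
  imports Defs
begin

text \<open>Comparing coefficients, \<open>\<partial>\<^sub>i(a) = u\<^sub>i\<close> says that the coefficients of \<open>u\<^sub>i\<close> at the sets containing
  \<open>i\<close> vanish, and that \<open>u\<^sub>i(\<gamma>) = \<plusminus> a(\<gamma> \<union> {i})\<close> for \<open>i \<notin> \<gamma>\<close>. So \<open>a(\<delta>)\<close> is prescribed once for every
  \<open>i \<in> \<delta>\<close>, and the skew symmetry of \<open>\<partial>\<^sub>i(u\<^sub>j)\<close> is exactly the agreement of the prescriptions coming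
  from \<open>i\<close> and \<open>j\<close>. Taking \<open>i = min \<delta>\<close>, where the sign is \<open>+\<close>, gives the formula: \<open>\<phi>\<close> is the projection
  onto \<open>K\<close>, and differentiating in increasing order makes the constant term of \<open>u\<^sub>\<delta>\<close> the coefficient
  of \<open>u\<^sub>i\<close> at \<open>\<delta> - {i}\<close>.\<close>

section \<open>Parity of inversion counts\<close>

lemma inversions_insert_right:
  assumes "finite A" "j \<notin> A"
  shows "inversions {i} (insert j A) = inversions {i} {j} + inversions {i} A"
  using inversions_Un_right[of "{i}" "{j}" A] assms by simp

text \<open>Exactly one of \<open>i < j\<close> and \<open>j < i\<close> holds, so the two counts
  add up to 1. This single sign is the source of all skew symmetry below.\<close>

lemma even_inversions_singletons:
  assumes "i \<noteq> j"
  shows "even (inversions {i} {j}) = odd (inversions {j} {i})"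
  using inversions_single[of "{i}" j] assms by (auto dest: arg_cong[where f = even])

context ring
begin

section \<open>Coefficients of partial derivatives\<close>

lemma gpartial_closed:
  assumes "i \<in> {1..n}" "f \<in> carrier (grassmann R n)"
  shows "gpartial R n i f \<in> carrier (grassmann R n)"
  using gpartial_is_left_skew_partial[OF assms(1)] assms(2)
  by (auto simp: is_left_skew_partial_def)

text \<open>\<open>gpartial\<close> is only a definite description. The explicit operator that
  witnesses existence satisfies the same axioms, so uniqueness identifies the two on the
  carrier.\<close>

lemma gcoeff_partial:
  assumes "i \<in> {1..n}" "f \<in> carrier (grassmann R n)" "\<gamma> \<subseteq> {1..n}"
  shows "gpartial R n i f \<gamma> = (if i \<in> \<gamma> then \<zero> else gsign (inversions {i} \<gamma>) (f (insert i \<gamma>)))"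
  using left_skew_partial_unique[OF gpartial_is_left_skew_partial left_skew_partial_exists, OF assms(1,1,2)]
    assms(3) by simp

lemma gpartial_eq_iff:
  assumes i: "i \<in> {1..n}" and a: "a \<in> carrier (grassmann R n)" and f: "f \<in> carrier (grassmann R n)"
  shows "gpartial R n i a = f \<longleftrightarrow>
    (\<forall>\<gamma>\<subseteq>{1..n}. f \<gamma> = (if i \<in> \<gamma> then \<zero> else gsign (inversions {i} \<gamma>) (a (insert i \<gamma>))))"
  using gcoeff_partial[OF i a] gcoeff_eqI[OF gpartial_closed[OF i a] f] by auto

section \<open>The subring omitting one variable\<close>

text \<open>Every splitting of \<gamma> puts \<open>i\<close> into one of its two pieces, so each
  summand of the product coefficient has a zero factor.\<close>

lemma gcoeff_mult_zero:
  assumes f: "f \<in> carrier (grassmann R n)" and g: "g \<in> carrier (grassmann R n)"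
    and f0: "\<And>\<gamma>. \<gamma> \<subseteq> {1..n} \<Longrightarrow> i \<in> \<gamma> \<Longrightarrow> f \<gamma> = \<zero>"
    and g0: "\<And>\<gamma>. \<gamma> \<subseteq> {1..n} \<Longrightarrow> i \<in> \<gamma> \<Longrightarrow> g \<gamma> = \<zero>"
    and \<gamma>: "\<gamma> \<subseteq> {1..n}" "i \<in> \<gamma>"
  shows "(f \<otimes>\<^bsub>grassmann R n\<^esub> g) \<gamma> = \<zero>"
  unfolding gcoeff_mult[OF \<gamma>(1)]
proof (rule add.finprod_one_eqI)
  fix \<alpha> assume "\<alpha> \<in> Pow \<gamma>"
  then have \<alpha>: "\<alpha> \<subseteq> {1..n}" "\<gamma> - \<alpha> \<subseteq> {1..n}" using \<gamma>(1) by auto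
  note c = gcoeff_closed[OF f \<alpha>(1)] gcoeff_closed[OF g \<alpha>(2)]
  have "f \<alpha> \<otimes> g (\<gamma> - \<alpha>) = \<zero>"
    using f0[OF \<alpha>(1)] g0[OF \<alpha>(2)] \<gamma>(2) c by (cases "i \<in> \<alpha>") auto
  then show "gsign (inversions \<alpha> (\<gamma> - \<alpha>)) (f \<alpha> \<otimes> g (\<gamma> - \<alpha>)) = \<zero>" by simp
qed

text \<open>The generators have no coefficient at a set containing \<open>i\<close>, and the ring
  operations preserve this. Conversely, in the monomial expansion of such an \<open>f\<close> the
  terms with \<open>i\<close> in \<alpha> are zero, and every other term is a product of
  generators.\<close>

lemma grassmann_omit_iff:
  "f \<in> grassmann_omit R n i \<longleftrightarrow>
    f \<in> carrier (grassmann R n) \<and> (\<forall>\<gamma>\<subseteq>{1..n}. i \<in> \<gamma> \<longrightarrow> f \<gamma> = \<zero>)"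
proof
  assume "f \<in> grassmann_omit R n i"
  then show "f \<in> carrier (grassmann R n) \<and> (\<forall>\<gamma>\<subseteq>{1..n}. i \<in> \<gamma> \<longrightarrow> f \<gamma> = \<zero>)"
    unfolding grassmann_omit_def
  proof (induction rule: generate_ring.induct)
    case one
    then show ?case using gone_closed by auto
  next
    case (incl h)
    then show ?case
      using gconst_closed gvar_closed by (auto simp: gconst_def gvar_def)
  next
    case (a_inv h)
    then show ?case
      using abelian_group.a_inv_closed[OF ring.is_abelian_group[OF ring_grassmann]]
      by (auto simp: gcoeff_a_inv)
  next
    case (eng_add g h)
    then show ?case by (auto intro: gadd_closed)
  next
    case (eng_mult g h)
    then show ?case using gmult_closed[of g n h] gcoeff_mult_zero[of g n h i] by blast
  qed
next
  interpret L: ring "grassmann R n" by (rule ring_grassmann)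
  let ?G = "generate_ring (grassmann R n) (gconst R n ` carrier R \<union> gvar R n ` ({1..n} - {i}))"
  assume A: "f \<in> carrier (grassmann R n) \<and> (\<forall>\<gamma>\<subseteq>{1..n}. i \<in> \<gamma> \<longrightarrow> f \<gamma> = \<zero>)"
  then have f: "f \<in> carrier (grassmann R n)" and f0: "\<And>\<gamma>. \<gamma> \<subseteq> {1..n} \<Longrightarrow> i \<in> \<gamma> \<Longrightarrow> f \<gamma> = \<zero>"
    by auto
  let ?t = "\<lambda>\<alpha>. gconst R n (f \<alpha>) \<otimes>\<^bsub>grassmann R n\<^esub> gmonom R n \<alpha>"
  have tc: "?t \<alpha> \<in> carrier (grassmann R n)" if "\<alpha> \<subseteq> {1..n}" for \<alpha>
    using f that by (auto intro!: gmult_closed gconst_closed gmonom_closed)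
  have "foldr (\<lambda>i m. gvar R n i \<otimes>\<^bsub>grassmann R n\<^esub> m) xs \<one>\<^bsub>grassmann R n\<^esub> \<in> ?G"
    if "set xs \<subseteq> {1..n} - {i}" for xs
    using that by (induction xs) (auto intro!: generate_ring.eng_mult generate_ring.one intro: generate_ring.incl)
  then have mon: "gmonom R n \<alpha> \<in> ?G" if "\<alpha> \<subseteq> {1..n} - {i}" for \<alpha>
    using that finite_subset[OF that] by (simp add: gmonom_def)
  have t: "?t \<alpha> \<in> ?G" if \<alpha>: "\<alpha> \<subseteq> {1..n}" for \<alpha>
  proof (cases "i \<in> \<alpha>")
    case True
    have "gconst R n \<zero> = \<zero>\<^bsub>grassmann R n\<^esub>"
      by (simp add: grassmann_def gconst_def cong: if_cong)
    then show ?thesis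
      using f0[OF \<alpha> True] gmonom_closed[of n \<alpha>] L.zero_in_generate by simp
  next
    case False
    then show ?thesis
      using gcoeff_closed[OF f \<alpha>] mon[of \<alpha>] \<alpha> by (auto intro!: generate_ring.eng_mult generate_ring.one intro: generate_ring.incl)
  qed
  have "finsum (grassmann R n) ?t S \<in> ?G" if "finite S" "S \<subseteq> Pow {1..n}" for S
    using that
  proof (induction S rule: finite_induct)
    case empty
    show ?case using L.zero_in_generate by simp
  next
    case (insert \<alpha> S)
    have "?t \<in> S \<rightarrow> carrier (grassmann R n)" "?t \<alpha> \<in> carrier (grassmann R n)"
      using insert.prems tc by auto
    then show ?case
      using insert t[of \<alpha>] by (simp add: generate_ring.eng_add)
  qed
  from this[of "Pow {1..n}"] show "f \<in> grassmann_omit R n i"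
    using grassmann_expansion[OF f] by (simp add: grassmann_omit_def)
qed

section \<open>The projection onto constants and iterated derivatives\<close>

text \<open>The factor of \<phi> for index \<open>i\<close> deletes the coefficients at sets
  containing \<open>i\<close> and keeps all others. After the indices from 1 to \<open>n\<close>
  only the coefficient at the empty set survives.\<close>

lemma gphi_eq_gconst:
  assumes f: "f \<in> carrier (grassmann R n)"
  shows "gphi R n f = gconst R n (f {})"
proof -
  interpret L: ring "grassmann R n" by (rule ring_grassmann)
  let ?s = "\<lambda>i b. b \<ominus>\<^bsub>grassmann R n\<^esub> (gvar R n i \<otimes>\<^bsub>grassmann R n\<^esub> gpartial R n i b)"
  have c: "?s i b \<in> carrier (grassmann R n)"
    if "i \<in> {1..n}" "b \<in> carrier (grassmann R n)" for i b
    using that by (intro L.minus_closed gmult_closed gvar_closed gpartial_closed)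
  have s: "?s i b \<gamma> = (if i \<in> \<gamma> then \<zero> else b \<gamma>)"
    if i: "i \<in> {1..n}" and b: "b \<in> carrier (grassmann R n)" and \<gamma>: "\<gamma> \<subseteq> {1..n}" for i b \<gamma>
  proof -
    note p = gpartial_closed[OF i b]
    have g: "\<gamma> - {i} \<subseteq> {1..n}" using \<gamma> by auto
    \<comment> \<open>Differentiating removes \<open>i\<close> and multiplying puts it back; both
      contribute the sign of \<open>inversions {i} (\<gamma> - {i})\<close>, so the signs
      cancel.\<close>
    have "(gvar R n i \<otimes>\<^bsub>grassmann R n\<^esub> gpartial R n i b) \<gamma> = (if i \<in> \<gamma> then b \<gamma> else \<zero>)"
      unfolding gcoeff_var_mult[OF i p \<gamma>] gcoeff_partial[OF i b g]
      using gcoeff_closed[OF b \<gamma>] by (auto simp: insert_absorb gsign_gsign gsign_eq)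
    then show ?thesis
      using gcoeff_closed[OF b \<gamma>] gcoeff_a_inv[OF gmult_closed[OF gvar_closed p] \<gamma>] \<gamma>
      by (simp add: a_minus_def r_neg)
  qed
  have "fold ?s xs b \<in> carrier (grassmann R n) \<and>
      (\<forall>\<gamma>\<subseteq>{1..n}. fold ?s xs b \<gamma> = (if set xs \<inter> \<gamma> = {} then b \<gamma> else \<zero>))"
    if "set xs \<subseteq> {1..n}" "b \<in> carrier (grassmann R n)" for xs b
    using that
  proof (induction xs arbitrary: b)
    case (Cons i xs)
    then show ?case using c[of i b] s[of i b] by auto
  qed simp
  from this[of "[1..<Suc n]" f] f
  have F: "gphi R n f \<in> carrier (grassmann R n)"
    "\<And>\<gamma>. \<gamma> \<subseteq> {1..n} \<Longrightarrow> gphi R n f \<gamma> = (if {1..n} \<inter> \<gamma> = {} then f \<gamma> else \<zero>)"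
    unfolding gphi_def by (simp_all add: atLeastLessThanSuc_atLeastAtMost del: upt_Suc)
  show ?thesis
  proof (rule gcoeff_eqI[OF F(1)])
    show "gconst R n (f {}) \<in> carrier (grassmann R n)"
      using gcoeff_closed[OF f, of "{}"] by (simp add: gconst_closed)
    fix \<gamma> :: "nat set" assume \<gamma>: "\<gamma> \<subseteq> {1..n}"
    then have "{1..n} \<inter> \<gamma> = \<gamma>" by auto
    then show "gphi R n f \<gamma> = gconst R n (f {}) \<gamma>"
      using F(2)[OF \<gamma>] \<gamma> by (simp add: gconst_def)
  qed
qed

text \<open>In an increasing list each index precedes all later ones, so no derivative contributes a
  sign when the constant term is traced back to a coefficient of \<open>f\<close>.\<close>

lemma fold_gpartial:
  assumes "sorted_wrt (<) xs" "set xs \<subseteq> {1..n}" "f \<in> carrier (grassmann R n)"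
  shows "fold (gpartial R n) xs f \<in> carrier (grassmann R n)"
    and "fold (gpartial R n) xs f {} = f (set xs)"
proof -
  have "fold (gpartial R n) xs f \<in> carrier (grassmann R n) \<and>
      fold (gpartial R n) xs f {} = f (set xs)"
    using assms
  proof (induction xs arbitrary: f)
    case (Cons i xs)
    then have "inversions {i} (set xs) = 0"
      by (intro inversions_le) (auto intro: less_imp_le)
    then have "gpartial R n i f (set xs) = f (set (i # xs))"
      using Cons.prems gcoeff_closed[OF Cons.prems(3), of "set (i # xs)"]
      by (auto simp: gcoeff_partial)
    then show ?case
      using Cons.IH[of "gpartial R n i f"] Cons.prems by (simp add: gpartial_closed)
  qed simp
  then show "fold (gpartial R n) xs f \<in> carrier (grassmann R n)"
    "fold (gpartial R n) xs f {} = f (set xs)" by auto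
qed

text \<open>The head of the sorted list is the minimum and its tail lists the remaining elements
  increasingly, so \<open>fold_gpartial\<close> applies to \<open>u (Min \<alpha>)\<close>.\<close>

lemma iterated_partial:
  assumes u: "\<And>i. i \<in> {1..n} \<Longrightarrow> u i \<in> carrier (grassmann R n)"
    and \<alpha>: "\<alpha> \<subseteq> {1..n}" "\<alpha> \<noteq> {}"
  shows "iterated_partial R n u \<alpha> \<in> carrier (grassmann R n)"
    and "iterated_partial R n u \<alpha> {} = u (Min \<alpha>) (\<alpha> - {Min \<alpha>})"
proof -
  have fin: "finite \<alpha>" using \<alpha>(1) finite_subset by blast
  let ?xs = "sorted_list_of_set (\<alpha> - {Min \<alpha>})"
  have xs: "sorted_list_of_set \<alpha> = Min \<alpha> # ?xs"
    using sorted_list_of_set_nonempty[OF fin \<alpha>(2)] .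
  have s: "sorted_wrt (<) ?xs" "set ?xs = \<alpha> - {Min \<alpha>}" using fin by auto
  have m: "u (Min \<alpha>) \<in> carrier (grassmann R n)" "set ?xs \<subseteq> {1..n}"
    using Min_in[OF fin \<alpha>(2)] \<alpha>(1) u s(2) by blast+
  show "iterated_partial R n u \<alpha> \<in> carrier (grassmann R n)"
    "iterated_partial R n u \<alpha> {} = u (Min \<alpha>) (\<alpha> - {Min \<alpha>})"
    using fold_gpartial[OF s(1) m(2,1)] s(2) by (simp_all add: iterated_partial_def xs)
qed

section \<open>The candidate solution and its coefficients\<close>

text \<open>Unlike in \<open>grassmann_expansion\<close>, the index sets and the coefficients are
  arbitrary here, so that sums over nonempty sets can be evaluated.\<close>

lemma gcoeff_sum_monom:
  assumes A: "A \<subseteq> Pow {1..n}" and k: "\<And>\<alpha>. \<alpha> \<in> A \<Longrightarrow> k \<alpha> \<in> carrier R"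
  shows "(\<Oplus>\<^bsub>grassmann R n\<^esub>\<alpha>\<in>A. gconst R n (k \<alpha>) \<otimes>\<^bsub>grassmann R n\<^esub> gmonom R n \<alpha>) \<in> carrier (grassmann R n)"
    and "\<gamma> \<subseteq> {1..n} \<Longrightarrow>
      (\<Oplus>\<^bsub>grassmann R n\<^esub>\<alpha>\<in>A. gconst R n (k \<alpha>) \<otimes>\<^bsub>grassmann R n\<^esub> gmonom R n \<alpha>) \<gamma> =
      (if \<gamma> \<in> A then k \<gamma> else \<zero>)"
proof -
  interpret L: ring "grassmann R n" by (rule ring_grassmann)
  let ?t = "\<lambda>\<alpha>. gconst R n (k \<alpha>) \<otimes>\<^bsub>grassmann R n\<^esub> gmonom R n \<alpha>"
  have T: "?t \<in> A \<rightarrow> carrier (grassmann R n)"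
    using k by (auto intro!: gmult_closed gconst_closed gmonom_closed)
  show "finsum (grassmann R n) ?t A \<in> carrier (grassmann R n)"
    using T by (rule L.finsum_closed)
  assume \<gamma>: "\<gamma> \<subseteq> {1..n}"
  have fin: "finite A" using A finite_subset by blast
  have "finsum (grassmann R n) ?t A \<gamma> = (\<Oplus>\<alpha>\<in>A. ?t \<alpha> \<gamma>)"
    by (rule gcoeff_finsum[OF fin T \<gamma>])
  also have "\<dots> = (\<Oplus>\<alpha>\<in>A. if \<alpha> = \<gamma> then k \<alpha> else \<zero>)"
  proof (intro finsum_cong' refl)
    fix \<alpha> assume "\<alpha> \<in> A"
    then show "?t \<alpha> \<gamma> = (if \<alpha> = \<gamma> then k \<alpha> else \<zero>)"
      using A k[of \<alpha>] \<gamma> by (auto simp: gcoeff_const_mult gmonom_closed gcoeff_monom subset_iff)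
  qed (use k in auto)
  also have "\<dots> = (if \<gamma> \<in> A then k \<gamma> else \<zero>)"
  proof (cases "\<gamma> \<in> A")
    case True
    then show ?thesis using add.finprod_singleton_swap[OF True fin, of k] k by auto
  next
    case False
    then show ?thesis by (auto intro!: add.finprod_one_eqI)
  qed
  finally show "finsum (grassmann R n) ?t A \<gamma> = (if \<gamma> \<in> A then k \<gamma> else \<zero>)" .
qed

text \<open>The right-hand side of the solution formula, with \<open>c\<close> in the role of
  \<lambda>.\<close>

definition gantiderivative :: "nat \<Rightarrow> (nat \<Rightarrow> nat set \<Rightarrow> 'a) \<Rightarrow> 'a \<Rightarrow> nat set \<Rightarrow> 'a" where
  "gantiderivative n u c = gconst R n c \<oplus>\<^bsub>grassmann R n\<^esub>
     (\<Oplus>\<^bsub>grassmann R n\<^esub>\<alpha>\<in>Pow {1..n} - {{}}.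
        gphi R n (iterated_partial R n u \<alpha>) \<otimes>\<^bsub>grassmann R n\<^esub> gmonom R n \<alpha>)"

text \<open>Since \<phi> yields constants, the formula is a monomial expansion, and its coefficients
  are the constant terms of the iterated derivatives.\<close>

lemma gantiderivative:
  assumes u: "\<And>i. i \<in> {1..n} \<Longrightarrow> u i \<in> carrier (grassmann R n)" and c: "c \<in> carrier R"
  shows "gantiderivative n u c \<in> carrier (grassmann R n)"
    and "\<gamma> \<subseteq> {1..n} \<Longrightarrow> gantiderivative n u c \<gamma> =
      (if \<gamma> = {} then c else u (Min \<gamma>) (\<gamma> - {Min \<gamma>}))"
proof -
  interpret L: ring "grassmann R n" by (rule ring_grassmann)
  let ?A = "Pow {1..n} - {{}}"
  let ?k = "\<lambda>\<alpha>. iterated_partial R n u \<alpha> {}"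
  \<comment> \<open>The empty set stays excluded: \<open>iterated_partial\<close> takes the
    \<open>hd\<close> of the sorted list.\<close>
  have k: "?k \<alpha> \<in> carrier R" if "\<alpha> \<in> ?A" for \<alpha>
    using that iterated_partial(1)[of n u \<alpha>, OF u] by (auto intro: gcoeff_closed[of _ n])
  have "(\<Oplus>\<^bsub>grassmann R n\<^esub>\<alpha>\<in>?A. gphi R n (iterated_partial R n u \<alpha>) \<otimes>\<^bsub>grassmann R n\<^esub> gmonom R n \<alpha>) =
      (\<Oplus>\<^bsub>grassmann R n\<^esub>\<alpha>\<in>?A. gconst R n (?k \<alpha>) \<otimes>\<^bsub>grassmann R n\<^esub> gmonom R n \<alpha>)"
  proof (intro L.finsum_cong' refl funcsetI)
    fix \<alpha> assume \<alpha>: "\<alpha> \<in> ?A"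
    show "gconst R n (?k \<alpha>) \<otimes>\<^bsub>grassmann R n\<^esub> gmonom R n \<alpha> \<in> carrier (grassmann R n)"
      by (intro gmult_closed gconst_closed gmonom_closed k \<alpha>)
    have "gphi R n (iterated_partial R n u \<alpha>) = gconst R n (?k \<alpha>)"
      using \<alpha> by (intro gphi_eq_gconst iterated_partial(1) u) auto
    then show "gphi R n (iterated_partial R n u \<alpha>) \<otimes>\<^bsub>grassmann R n\<^esub> gmonom R n \<alpha> =
        gconst R n (?k \<alpha>) \<otimes>\<^bsub>grassmann R n\<^esub> gmonom R n \<alpha>" by simp
  qed
  then have S: "gantiderivative n u c = gconst R n c \<oplus>\<^bsub>grassmann R n\<^esub>
      (\<Oplus>\<^bsub>grassmann R n\<^esub>\<alpha>\<in>?A. gconst R n (?k \<alpha>) \<otimes>\<^bsub>grassmann R n\<^esub> gmonom R n \<alpha>)"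
    by (simp add: gantiderivative_def)
  show "gantiderivative n u c \<in> carrier (grassmann R n)"
    unfolding S using c k by (intro gadd_closed gconst_closed gcoeff_sum_monom(1)) auto
  assume \<gamma>: "\<gamma> \<subseteq> {1..n}"
  have "(\<Oplus>\<^bsub>grassmann R n\<^esub>\<alpha>\<in>?A. gconst R n (?k \<alpha>) \<otimes>\<^bsub>grassmann R n\<^esub> gmonom R n \<alpha>) \<gamma> =
      (if \<gamma> \<in> ?A then ?k \<gamma> else \<zero>)"
    by (rule gcoeff_sum_monom(2)) (use k \<gamma> in auto)
  then have "gantiderivative n u c \<gamma> =
      (if \<gamma> = {} then c else \<zero>) \<oplus> (if \<gamma> = {} then \<zero> else ?k \<gamma>)"
    unfolding S gcoeff_add[OF \<gamma>] using \<gamma> by (simp add: gconst_def)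
  then show "gantiderivative n u c \<gamma> = (if \<gamma> = {} then c else u (Min \<gamma>) (\<gamma> - {Min \<gamma>}))"
    using \<gamma> c k[of \<gamma>] iterated_partial(2)[of n u \<gamma>, OF u] by simp
qed

section \<open>Skew symmetry and compatibility of the equations\<close>

text \<open>For \<open>i\<close> and \<open>j\<close> outside \<gamma>, both sides read the
  coefficient of \<open>a\<close> at \<gamma> with \<open>i\<close> and \<open>j\<close> inserted,
  and the order of \<open>i\<close> and \<open>j\<close> accounts for the minus sign. Otherwise both
  sides vanish. This gives the necessity of the second condition.\<close>

lemma gpartial_anticommute:
  assumes i: "i \<in> {1..n}" and j: "j \<in> {1..n}" and "i \<noteq> j" and a: "a \<in> carrier (grassmann R n)"
  shows "gpartial R n i (gpartial R n j a) = \<ominus>\<^bsub>grassmann R n\<^esub> gpartial R n j (gpartial R n i a)"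
proof (rule gcoeff_eqI[of _ n])
  interpret L: ring "grassmann R n" by (rule ring_grassmann)
  note c = gpartial_closed[OF i a] gpartial_closed[OF j a]
  show "gpartial R n i (gpartial R n j a) \<in> carrier (grassmann R n)"
    "\<ominus>\<^bsub>grassmann R n\<^esub> gpartial R n j (gpartial R n i a) \<in> carrier (grassmann R n)"
    by (intro L.a_inv_closed gpartial_closed i j c)+
  fix \<gamma> :: "nat set" assume \<gamma>: "\<gamma> \<subseteq> {1..n}"
  have fin: "finite \<gamma>" using \<gamma> finite_subset by blast
  have g: "insert i \<gamma> \<subseteq> {1..n}" "insert j \<gamma> \<subseteq> {1..n}" "insert i (insert j \<gamma>) \<subseteq> {1..n}"
    using i j \<gamma> by auto
  have z: "a (insert i (insert j \<gamma>)) \<in> carrier R" using gcoeff_closed[OF a g(3)] .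
  note I = inversions_insert_right[OF fin]
  note J = even_inversions_singletons[OF assms(3)]
  have ij: "insert j (insert i \<gamma>) = insert i (insert j \<gamma>)" by (rule insert_commute)
  show "gpartial R n i (gpartial R n j a) \<gamma> = (\<ominus>\<^bsub>grassmann R n\<^esub> gpartial R n j (gpartial R n i a)) \<gamma>"
    unfolding gcoeff_a_inv[OF gpartial_closed[OF j c(1)] \<gamma>] gcoeff_partial[OF i c(2) \<gamma>]
      gcoeff_partial[OF j c(1) \<gamma>] gcoeff_partial[OF i a g(2)] gcoeff_partial[OF j a g(1)] ij
    using assms(3) z J by (auto simp: gsign_eq I)
qed

text \<open>With \<open>f\<close> and \<open>g\<close> as the right-hand sides for \<open>i\<close>
  and \<open>j\<close>, the two sides are the values that the two equations prescribe for the same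
  coefficient of a solution. The coefficient of \<open>fg\<close> at \<gamma> makes them equal, its
  minus sign being absorbed by the order of \<open>i\<close> and \<open>j\<close>.\<close>

lemma gsystem_compatible:
  assumes i: "i \<in> {1..n}" and j: "j \<in> {1..n}" and ij: "i \<noteq> j"
    and f: "f \<in> carrier (grassmann R n)" and g: "g \<in> carrier (grassmann R n)"
    and fg: "gpartial R n j f = \<ominus>\<^bsub>grassmann R n\<^esub> gpartial R n i g"
    and \<gamma>: "\<gamma> \<subseteq> {1..n}" "i \<notin> \<gamma>" "j \<notin> \<gamma>"
  shows "gsign (inversions {i} (insert j \<gamma>)) (f (insert j \<gamma>)) =
    gsign (inversions {j} (insert i \<gamma>)) (g (insert i \<gamma>))"
proof -
  have fin: "finite \<gamma>" using \<gamma> finite_subset by blast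
  have F: "f (insert j \<gamma>) \<in> carrier R" and G: "g (insert i \<gamma>) \<in> carrier R"
    using i j \<gamma> by (auto intro!: gcoeff_closed[OF f] gcoeff_closed[OF g])
  note I = inversions_insert_right[OF fin]
  note J = even_inversions_singletons[OF ij]
  have "gsign (inversions {j} \<gamma>) (f (insert j \<gamma>)) = \<ominus> gsign (inversions {i} \<gamma>) (g (insert i \<gamma>))"
    using arg_cong[OF fg, of "\<lambda>h. h \<gamma>"] \<gamma>
    by (simp add: gcoeff_a_inv[OF gpartial_closed[OF i g]] gcoeff_partial[OF i g] gcoeff_partial[OF j f])
  \<comment> \<open>A sign applied twice cancels, which isolates the coefficient of
    \<open>f\<close>; the minus sign then becomes the \<open>Suc\<close> in the exponent.\<close>
  then have "gsign (inversions {j} \<gamma>) (gsign (inversions {j} \<gamma>) (f (insert j \<gamma>))) =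
      gsign (inversions {j} \<gamma>) (\<ominus> gsign (inversions {i} \<gamma>) (g (insert i \<gamma>)))" by simp
  then have "f (insert j \<gamma>) = gsign (Suc (inversions {i} \<gamma> + inversions {j} \<gamma>)) (g (insert i \<gamma>))"
    using F G by (simp add: gsign_gsign gsign_eq split: if_splits)
  then show ?thesis
    using G J by (auto simp: gsign_eq I \<gamma>)
qed

section \<open>Uniqueness and existence of solutions\<close>

text \<open>For nonempty \<gamma>, the equation for the least index alone fixes the coefficient of
  \<open>a\<close> at \<gamma>, without a sign. Only the constant term remains free.\<close>

lemma gantiderivative_unique:
  assumes u: "\<And>i. i \<in> {1..n} \<Longrightarrow> u i \<in> carrier (grassmann R n)"
    and a: "a \<in> carrier (grassmann R n)" and sol: "\<And>i. i \<in> {1..n} \<Longrightarrow> gpartial R n i a = u i"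
  shows "a = gantiderivative n u (a {})"
proof -
  have c: "a {} \<in> carrier R" using gcoeff_closed[OF a, of "{}"] by simp
  show ?thesis
  proof (rule gcoeff_eqI[OF a gantiderivative(1)[OF u c]])
    fix \<gamma> :: "nat set" assume \<gamma>: "\<gamma> \<subseteq> {1..n}"
    have "u (Min \<gamma>) (\<gamma> - {Min \<gamma>}) = a \<gamma>" if ne: "\<gamma> \<noteq> {}"
    proof -
      have fin: "finite \<gamma>" using \<gamma> finite_subset by blast
      have m: "Min \<gamma> \<in> \<gamma>" using Min_in[OF fin ne] .
      then have mn: "Min \<gamma> \<in> {1..n}" and s: "\<gamma> - {Min \<gamma>} \<subseteq> {1..n}" using \<gamma> by auto
      have "inversions {Min \<gamma>} (\<gamma> - {Min \<gamma>}) = 0"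
        using fin by (intro inversions_le) auto
      then show ?thesis
        using gcoeff_partial[OF mn a s] gcoeff_closed[OF a \<gamma>] m by (simp add: sol[OF mn] insert_absorb)
    qed
    then show "a \<gamma> = gantiderivative n u (a {}) \<gamma>"
      using gantiderivative(2)[of n u "a {}" \<gamma>, OF u c \<gamma>] by auto
  qed
qed

text \<open>The candidate is built from the equations for least indices. The equation for any other
  index of a set follows because the compatibility condition transfers its prescription to the
  minimum; at sets containing \<open>i\<close> the equation is the condition
  \<open>omit\<close>.\<close>

lemma gpartial_gantiderivative:
  assumes omit: "\<And>i. i \<in> {1..n} \<Longrightarrow> u i \<in> grassmann_omit R n i"
    and skew: "\<And>i j. i \<in> {1..n} \<Longrightarrow> j \<in> {1..n} \<Longrightarrow> i \<noteq> j \<Longrightarrow>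
      gpartial R n i (u j) = \<ominus>\<^bsub>grassmann R n\<^esub> gpartial R n j (u i)"
    and c: "c \<in> carrier R" and i: "i \<in> {1..n}"
  shows "gpartial R n i (gantiderivative n u c) = u i"
proof -
  have u: "u j \<in> carrier (grassmann R n)" if "j \<in> {1..n}" for j
    using omit[OF that] by (simp add: grassmann_omit_iff)
  let ?a = "gantiderivative n u c"
  have a: "?a \<in> carrier (grassmann R n)" by (rule gantiderivative(1)[OF u c])
  show ?thesis
    unfolding gpartial_eq_iff[OF i a u[OF i]]
  proof (intro allI impI)
    fix \<gamma> :: "nat set" assume \<gamma>: "\<gamma> \<subseteq> {1..n}"
    show "u i \<gamma> = (if i \<in> \<gamma> then \<zero> else gsign (inversions {i} \<gamma>) (?a (insert i \<gamma>)))"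
    proof (cases "i \<in> \<gamma>")
      case True
      then show ?thesis using omit[OF i] \<gamma> by (simp add: grassmann_omit_iff)
    next
      case False
      define \<delta> where "\<delta> = insert i \<gamma>"
      define m where "m = Min \<delta>"
      have \<delta>: "\<delta> \<subseteq> {1..n}" using i \<gamma> by (auto simp: \<delta>_def)
      have fin: "finite \<delta>" using \<delta> finite_subset by blast
      have m: "m \<in> \<delta>" using Min_in[OF fin] by (auto simp: m_def \<delta>_def)
      have mn: "m \<in> {1..n}" using m \<delta> by auto
      have I: "inversions {m} (\<delta> - {m}) = 0"
        using fin unfolding m_def by (intro inversions_le) auto
      have U: "u m (\<delta> - {m}) \<in> carrier R" "u i \<gamma> \<in> carrier R"
        using \<delta> \<gamma> by (auto intro!: gcoeff_closed[OF u[OF mn]] gcoeff_closed[OF u[OF i]])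
      have A: "?a \<delta> = u m (\<delta> - {m})"
        using gantiderivative(2)[of n u c \<delta>, OF u c \<delta>] m by (auto simp: m_def)
      have "gsign (inversions {i} \<gamma>) (u i \<gamma>) = u m (\<delta> - {m})"
      proof (cases "m = i")
        case True
        then show ?thesis using I U False by (simp add: \<delta>_def)
      next
        case ne: False
        \<comment> \<open>Compatibility of \<open>i\<close> and \<open>m\<close> is used over
          \<delta> without both of them, which is \<open>\<gamma> - {m}\<close>.\<close>
        have d: "insert m (\<gamma> - {m}) = \<gamma>" "insert i (\<gamma> - {m}) = \<delta> - {m}"
          using m ne by (auto simp: \<delta>_def)
        have "\<gamma> - {m} \<subseteq> {1..n}" "i \<notin> \<gamma> - {m}" "m \<notin> \<gamma> - {m}" using \<gamma> False by auto
        from gsystem_compatible[OF i mn ne[symmetric] u[OF i] u[OF mn] skew[OF mn i ne] this]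
        show ?thesis unfolding d I using U by simp
      qed
      then have "gsign (inversions {i} \<gamma>) (?a \<delta>) = gsign (inversions {i} \<gamma>) (gsign (inversions {i} \<gamma>) (u i \<gamma>))"
        unfolding A by simp
      then have "u i \<gamma> = gsign (inversions {i} \<gamma>) (?a \<delta>)"
        using U by (simp add: gsign_gsign gsign_eq)
      then show ?thesis using False by (simp add: \<delta>_def)
    qed
  qed
qed

lemma gpartial_in_grassmann_omit:
  assumes "i \<in> {1..n}" "a \<in> carrier (grassmann R n)"
  shows "gpartial R n i a \<in> grassmann_omit R n i"
  using assms by (simp add: grassmann_omit_iff gpartial_closed gcoeff_partial)

end

theorem theorem8p3:
  fixes K :: "('a, 'm) ring_scheme" and n :: nat and u :: "nat \<Rightarrow> nat set \<Rightarrow> 'a"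
  assumes "ring K"
    and "\<And>i. i \<in> {1..n} \<Longrightarrow> u i \<in> carrier (grassmann K n)"
  shows "((\<exists>a\<in>carrier (grassmann K n). \<forall>i\<in>{1..n}. gpartial K n i a = u i) \<longleftrightarrow>
           (\<forall>i\<in>{1..n}. u i \<in> grassmann_omit K n i) \<and>
           (\<forall>i\<in>{1..n}. \<forall>j\<in>{1..n}. i \<noteq> j \<longrightarrow>
              gpartial K n i (u j) = \<ominus>\<^bsub>grassmann K n\<^esub> gpartial K n j (u i))) \<and>
         ((\<forall>i\<in>{1..n}. u i \<in> grassmann_omit K n i) \<and>
          (\<forall>i\<in>{1..n}. \<forall>j\<in>{1..n}. i \<noteq> j \<longrightarrow>
              gpartial K n i (u j) = \<ominus>\<^bsub>grassmann K n\<^esub> gpartial K n j (u i)) \<longrightarrow>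
          {a \<in> carrier (grassmann K n). \<forall>i\<in>{1..n}. gpartial K n i a = u i} =
          {gconst K n c \<oplus>\<^bsub>grassmann K n\<^esub>
             (\<Oplus>\<^bsub>grassmann K n\<^esub>\<alpha>\<in>Pow {1..n} - {{}}.
                gphi K n (iterated_partial K n u \<alpha>) \<otimes>\<^bsub>grassmann K n\<^esub> gmonom K n \<alpha>)
           | c. c \<in> carrier K})"
proof -
  interpret ring K by (rule assms(1))
  let ?C = "(\<forall>i\<in>{1..n}. u i \<in> grassmann_omit K n i) \<and>
           (\<forall>i\<in>{1..n}. \<forall>j\<in>{1..n}. i \<noteq> j \<longrightarrow>
              gpartial K n i (u j) = \<ominus>\<^bsub>grassmann K n\<^esub> gpartial K n j (u i))"
  have necessary: "?C"
    if a: "a \<in> carrier (grassmann K n)" and sol: "\<forall>i\<in>{1..n}. gpartial K n i a = u i" for a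
  proof (intro conjI ballI impI)
    fix i assume i: "i \<in> {1..n}"
    then show "u i \<in> grassmann_omit K n i"
      using gpartial_in_grassmann_omit[OF i a] sol by simp
    fix j assume j: "j \<in> {1..n}" and "i \<noteq> j"
    then show "gpartial K n i (u j) = \<ominus>\<^bsub>grassmann K n\<^esub> gpartial K n j (u i)"
      using gpartial_anticommute[OF i j _ a] sol i by simp
  qed
  have solution: "gantiderivative n u c \<in> carrier (grassmann K n)"
    "\<forall>i\<in>{1..n}. gpartial K n i (gantiderivative n u c) = u i"
    if ?C "c \<in> carrier K" for c
    using that gantiderivative(1)[of n u c, OF assms(2)] gpartial_gantiderivative[of n u c] by blast+
  have all: "{a \<in> carrier (grassmann K n). \<forall>i\<in>{1..n}. gpartial K n i a = u i} =
      {gantiderivative n u c | c. c \<in> carrier K}" if C: ?C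
  proof (intro subset_antisym subsetI)
    fix a assume "a \<in> {a \<in> carrier (grassmann K n). \<forall>i\<in>{1..n}. gpartial K n i a = u i}"
    then have "a = gantiderivative n u (a {})" "a {} \<in> carrier K"
      using gantiderivative_unique[of n u a, OF assms(2)] gcoeff_closed[of a n "{}"] by auto
    then show "a \<in> {gantiderivative n u c | c. c \<in> carrier K}" by blast
  qed (use solution[OF C] in blast)
  \<comment> \<open>Solvability is witnessed by the candidate with constant term zero.\<close>
  show ?thesis
    using necessary solution[OF _ zero_closed] all unfolding gantiderivative_def by blast
qed

end
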